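(* Let $(M_1^{m_1},g_1)$ and $(M_2^{m_2},g_2)$, $m_1\ge1$, $m_2\ge0$, be Einstein manifolds with $m_2(m_2-1)\,\mathrm{Sc}(g_1)=-m_1(m_1-1)\,\mathrm{Sc}(g_2)$, and let $\lambda=2\mu>0$ satisfy $\mathrm{Sc}(g_1)=m_1(m_1-1)\lambda$ and $\mathrm{Sc}(g_2)=-m_2(m_2-1)\lambda$. Let $(\tilde M,\boldsymbol h)$ be the ambient manifold of $(M_1\times M_2,[g_1\times g_2])$ described in the context, with $\mathcal Q=\{\rho=0\}\subset\tilde M$. Then in a neighbourhood of $\mathcal Q\subset\tilde M$ the ambient metric $\boldsymbol h$ is the product of the cone metrics $$\overline g_1=\lambda s_1^2g_1+ds_1^2,\qquad \overline g_2=\lambda s_2^2g_2-ds_2^2;$$ that is, some open neighbourhood of $\mathcal Q$ in $(\tilde M,\boldsymbol h)$ is isometric, by a diffeomorphism covering the identity of $M_1\times M_2$, to the product $(\overline M_1\times\overline M_2,\ \overline g_1+\overline g_2)$, where $\overline M_i=M_i\times\mathbb R_+$ with coordinate $s_i$ on the factor $\mathbb R_+$.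
   Context: Metrics are pseudo-Riemannian. An $m$-manifold $(M,g)$ is Einstein if $\mathrm{Ric}(g)=\frac1m\mathrm{Sc}(g)\,g$ with scalar curvature $\mathrm{Sc}(g)$ constant; 1-manifolds are Einstein with $\mathrm{Sc}=0$, and $m_2=0$ means $M_2$ is a point (so $\mathrm{Sc}(g_2)=0$, the $g_2$ terms are absent, and $\overline M_2=\mathbb R_+$). The ambient manifold: let $g=g_1\times g_2$ on $M=M_1\times M_2$ and let $\mathcal Q\to M$ be the $\mathbb R_+$-bundle of metrics conformally related to $g$, with fibre coordinate $t>0$ given by writing points as $(p,t^2g(p))$. Put $\tilde M=\mathcal Q\times\tilde I$ with $\tilde I=\mathbb R\setminus\{-1/\mu\}$ if $m_2=0$ and $\tilde I=\mathbb R\setminus\{1/\mu,-1/\mu\}$ otherwise, let $\rho$ be the coordinate on $\tilde I$, identify $\mathcal Q$ with $\mathcal Q\times\{0\}$, and set $$\boldsymbol h=2t\,dt\,d\rho+2\rho\,dt^2+t^2\big[(1+\mu\rho)^2g_1+(1-\mu\rho)^2g_2\big].$$ *)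

theory Defs
  imports "HOL-Analysis.Analysis"
begin

section \<open>Model spaces\<close>

text \<open>
  Manifolds of dimension 0 must be covered, whereas every type of class \<open>euclidean_space\<close> has
  positive dimension. The model space of an \<open>m\<close>-manifold is therefore any finite-dimensional type of
  class \<open>real_normed_vector\<close> whose dimension is \<open>m\<close>; the type \<open>unit\<close> serves for \<open>m = 0\<close>.
\<close>

instantiation unit :: real_normed_vector
begin

definition zero_unit :: unit where "0 = ()"
definition plus_unit :: "unit \<Rightarrow> unit \<Rightarrow> unit" where "x + y = ()"
definition scaleR_unit :: "real \<Rightarrow> unit \<Rightarrow> unit" where "c *\<^sub>R x = ()"
definition norm_unit :: "unit \<Rightarrow> real" where "norm (x :: unit) = 0"
definition dist_unit :: "unit \<Rightarrow> unit \<Rightarrow> real" where "dist (x :: unit) y = 0"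
definition sgn_unit :: "unit \<Rightarrow> unit" where "sgn (x :: unit) = ()"
definition uniformity_unit :: "(unit \<times> unit) filter"
  where "uniformity = (INF e\<in>{0 <..}. principal {(x :: unit, y). dist x y < e})"
definition open_unit :: "unit set \<Rightarrow> bool"
  where "open (U :: unit set) \<longleftrightarrow> (\<forall>x\<in>U. eventually (\<lambda>(x', y). x' = x \<longrightarrow> y \<in> U) uniformity)"

instance
  by standard (auto simp: norm_unit_def dist_unit_def uniformity_unit_def open_unit_def)

end

definition finite_dimensional :: "'e::real_normed_vector itself \<Rightarrow> bool"
  where "finite_dimensional _ \<longleftrightarrow> (\<exists>B :: 'e set. finite B \<and> span B = UNIV)"

definition lin_trace :: "('e::real_vector \<Rightarrow> 'e) \<Rightarrow> real"
  where "lin_trace L =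
    (let B = (SOME B. independent B \<and> span B = UNIV) in \<Sum>b\<in>B. representation B (L b) b)"

text \<open>Only used for open \<open>S\<close> in a finite-dimensional space; there, it suffices to differentiate
  repeatedly in the directions of constant vectors \<open>v\<close>.\<close>

primrec Ck_on :: "nat \<Rightarrow> ('e::real_normed_vector \<Rightarrow> 'f::real_normed_vector) \<Rightarrow> 'e set \<Rightarrow> bool" where
  "Ck_on 0 f S \<longleftrightarrow> continuous_on S f"
| "Ck_on (Suc k) f S \<longleftrightarrow>
     (\<forall>x\<in>S. f differentiable (at x)) \<and> (\<forall>v. Ck_on k (\<lambda>x. frechet_derivative f (at x) v) S)"

definition Cinf_on :: "('e::real_normed_vector \<Rightarrow> 'f::real_normed_vector) \<Rightarrow> 'e set \<Rightarrow> bool"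
  where "Cinf_on f S \<longleftrightarrow> (\<forall>k. Ck_on k f S)"


section \<open>Smooth manifolds given by an indexed atlas\<close>

record ('a, 'i, 'e) mfd =
  mtop :: "'a topology"
  mindex :: "'i set"
  mdom :: "'i \<Rightarrow> 'a set"
  mchart :: "'i \<Rightarrow> 'a \<Rightarrow> 'e"

abbreviation mcarrier :: "('a, 'i, 'e) mfd \<Rightarrow> 'a set"
  where "mcarrier M \<equiv> topspace (mtop M)"

definition chart_inv :: "('a, 'i, 'e) mfd \<Rightarrow> 'i \<Rightarrow> 'e \<Rightarrow> 'a"
  where "chart_inv M i = inv_into (mdom M i) (mchart M i)"

definition smooth_manifold :: "nat \<Rightarrow> ('a, 'i, 'e::real_normed_vector) mfd \<Rightarrow> bool"
  where "smooth_manifold m M \<longleftrightarrow>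
    finite_dimensional TYPE('e) \<and> dim (UNIV :: 'e set) = m \<and>
    Hausdorff_space (mtop M) \<and> second_countable (mtop M) \<and>
    mcarrier M = (\<Union>i\<in>mindex M. mdom M i) \<and>
    (\<forall>i\<in>mindex M. openin (mtop M) (mdom M i) \<and> open (mchart M i ` mdom M i) \<and>
       homeomorphic_map (subtopology (mtop M) (mdom M i)) (top_of_set (mchart M i ` mdom M i))
         (mchart M i)) \<and>
    (\<forall>i\<in>mindex M. \<forall>j\<in>mindex M.
       Cinf_on (mchart M j \<circ> chart_inv M i) (mchart M i ` (mdom M i \<inter> mdom M j)))"

definition open_submfd :: "('a, 'i, 'e) mfd \<Rightarrow> 'a set \<Rightarrow> ('a, 'i, 'e) mfd"
  where "open_submfd M U =
    \<lparr>mtop = subtopology (mtop M) U, mindex = mindex M,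
     mdom = (\<lambda>i. mdom M i \<inter> U), mchart = mchart M\<rparr>"

definition prod_mfd ::
    "('a, 'i, 'e) mfd \<Rightarrow> ('b, 'j, 'f) mfd \<Rightarrow> ('a \<times> 'b, 'i \<times> 'j, 'e \<times> 'f) mfd"
  where "prod_mfd M N =
    \<lparr>mtop = prod_topology (mtop M) (mtop N), mindex = mindex M \<times> mindex N,
     mdom = (\<lambda>(i, j). mdom M i \<times> mdom N j),
     mchart = (\<lambda>(i, j) (p, q). (mchart M i p, mchart N j q))\<rparr>"

definition line_mfd :: "real set \<Rightarrow> (real, unit, real) mfd"
  where "line_mfd S =
    \<lparr>mtop = top_of_set S, mindex = {()}, mdom = (\<lambda>_. S), mchart = (\<lambda>_ x. x)\<rparr>"

text \<open>The manifold structure on the set \<open>A\<close> that turns a bijection \<open>f\<close> from \<open>A\<close> onto the manifold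
  \<open>N\<close> into a diffeomorphism.\<close>

definition transport_mfd :: "'a set \<Rightarrow> ('a \<Rightarrow> 'b) \<Rightarrow> ('b, 'i, 'e) mfd \<Rightarrow> ('a, 'i, 'e) mfd"
  where "transport_mfd A f N =
    \<lparr>mtop = pullback_topology A f (mtop N), mindex = mindex N,
     mdom = (\<lambda>i. f -` mdom N i \<inter> A), mchart = (\<lambda>i. mchart N i \<circ> f)\<rparr>"

definition local_rep ::
    "('a, 'i, 'e) mfd \<Rightarrow> ('b, 'j, 'f) mfd \<Rightarrow> ('a \<Rightarrow> 'b) \<Rightarrow> 'i \<Rightarrow> 'j \<Rightarrow> 'e \<Rightarrow> 'f"
  where "local_rep M N F i j = mchart N j \<circ> F \<circ> chart_inv M i"

definition smooth_map ::
    "('a, 'i, 'e::real_normed_vector) mfd \<Rightarrow> ('b, 'j, 'f::real_normed_vector) mfd \<Rightarrow> ('a \<Rightarrow> 'b) \<Rightarrow> bool"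
  where "smooth_map M N F \<longleftrightarrow>
    continuous_map (mtop M) (mtop N) F \<and>
    (\<forall>i\<in>mindex M. \<forall>j\<in>mindex N.
       Cinf_on (local_rep M N F i j) (mchart M i ` (mdom M i \<inter> F -` mdom N j)))"

definition diffeomorphism ::
    "('a, 'i, 'e::real_normed_vector) mfd \<Rightarrow> ('b, 'j, 'f::real_normed_vector) mfd \<Rightarrow> ('a \<Rightarrow> 'b) \<Rightarrow> bool"
  where "diffeomorphism M N F \<longleftrightarrow>
    bij_betw F (mcarrier M) (mcarrier N) \<and> smooth_map M N F \<and>
    smooth_map N M (inv_into (mcarrier M) F)"


section \<open>Pseudo-Riemannian metrics\<close>

text \<open>
  A covariant 2-tensor field is given by its components in the charts of the atlas: \<open>g i p v w\<close> is the
  value at the point \<open>p\<close> on the tangent vectors represented by \<open>v\<close> and \<open>w\<close> in the chart \<open>i\<close>. Only the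
  values with \<open>i\<close> in the index set and \<open>p\<close> in the domain of \<open>i\<close> are meaningful.
\<close>

type_synonym ('a, 'i, 'e) tensor2 = "'i \<Rightarrow> 'a \<Rightarrow> 'e \<Rightarrow> 'e \<Rightarrow> real"

definition pseudo_riemannian ::
    "('a, 'i, 'e::real_normed_vector) mfd \<Rightarrow> ('a, 'i, 'e) tensor2 \<Rightarrow> bool"
  where "pseudo_riemannian M g \<longleftrightarrow>
    (\<forall>i\<in>mindex M. \<forall>p\<in>mdom M i.
       bilinear (g i p) \<and> (\<forall>v w. g i p v w = g i p w v) \<and>
       (\<forall>v. (\<forall>w. g i p v w = 0) \<longrightarrow> v = 0)) \<and>
    (\<forall>i\<in>mindex M. \<forall>v w. Cinf_on (\<lambda>x. g i (chart_inv M i x) v w) (mchart M i ` mdom M i)) \<and>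
    (\<forall>i\<in>mindex M. \<forall>j\<in>mindex M. \<forall>p\<in>mdom M i \<inter> mdom M j. \<forall>v w.
       g i p v w =
         (let D = frechet_derivative (mchart M j \<circ> chart_inv M i) (at (mchart M i p))
          in g j p (D v) (D w)))"

definition isometry ::
    "('a, 'i, 'e::real_normed_vector) mfd \<Rightarrow> ('a, 'i, 'e) tensor2 \<Rightarrow>
     ('b, 'j, 'f::real_normed_vector) mfd \<Rightarrow> ('b, 'j, 'f) tensor2 \<Rightarrow> ('a \<Rightarrow> 'b) \<Rightarrow> bool"
  where "isometry M g N h F \<longleftrightarrow>
    diffeomorphism M N F \<and>
    (\<forall>i\<in>mindex M. \<forall>j\<in>mindex N. \<forall>p\<in>mdom M i \<inter> F -` mdom N j. \<forall>v w.
       g i p v w =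
         (let D = frechet_derivative (local_rep M N F i j) (at (mchart M i p))
          in h j (F p) (D v) (D w)))"

definition metric_product ::
    "('a, 'i, 'e) tensor2 \<Rightarrow> ('b, 'j, 'f) tensor2 \<Rightarrow> ('a \<times> 'b, 'i \<times> 'j, 'e \<times> 'f) tensor2"
  where "metric_product g h =
    (\<lambda>(i, j) (p, q) (v, v') (w, w'). g i p v w + h j q v' w')"


section \<open>Curvature\<close>

text \<open>
  The following operators act on a metric \<open>G\<close> on an open subset of the model space. They use vector
  fields that are constant in the chart, so that the Levi-Civita connection is
  \<open>\<nabla>\<^sub>u v = christoffel G x u v\<close> by the Koszul formula, and the curvature operator is
  \<open>R(u, v) w = \<nabla>\<^sub>u \<nabla>\<^sub>v w - \<nabla>\<^sub>v \<nabla>\<^sub>u w\<close>. The Ricci tensor \<open>Ric(v, w)\<close> is the trace of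
  \<open>u \<mapsto> R(u, v) w\<close>, which is positive on round spheres.
\<close>

definition christoffel ::
    "('e::real_normed_vector \<Rightarrow> 'e \<Rightarrow> 'e \<Rightarrow> real) \<Rightarrow> 'e \<Rightarrow> 'e \<Rightarrow> 'e \<Rightarrow> 'e"
  where "christoffel G x u v = (THE z. \<forall>w. G x z w =
    (frechet_derivative (\<lambda>y. G y v w) (at x) u
     + frechet_derivative (\<lambda>y. G y u w) (at x) v
     - frechet_derivative (\<lambda>y. G y u v) (at x) w) / 2)"

definition local_curvature ::
    "('e::real_normed_vector \<Rightarrow> 'e \<Rightarrow> 'e \<Rightarrow> real) \<Rightarrow> 'e \<Rightarrow> 'e \<Rightarrow> 'e \<Rightarrow> 'e \<Rightarrow> 'e"
  where "local_curvature G x u v w =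
    frechet_derivative (\<lambda>y. christoffel G y v w) (at x) u
    - frechet_derivative (\<lambda>y. christoffel G y u w) (at x) v
    + christoffel G x u (christoffel G x v w)
    - christoffel G x v (christoffel G x u w)"

definition local_ricci ::
    "('e::real_normed_vector \<Rightarrow> 'e \<Rightarrow> 'e \<Rightarrow> real) \<Rightarrow> 'e \<Rightarrow> 'e \<Rightarrow> 'e \<Rightarrow> real"
  where "local_ricci G x v w = lin_trace (\<lambda>u. local_curvature G x u v w)"

definition local_scalar ::
    "('e::real_normed_vector \<Rightarrow> 'e \<Rightarrow> 'e \<Rightarrow> real) \<Rightarrow> 'e \<Rightarrow> real"
  where "local_scalar G x =
    lin_trace (\<lambda>v. THE z. \<forall>w. G x z w = local_ricci G x v w)"

definition ricci ::
    "('a, 'i, 'e::real_normed_vector) mfd \<Rightarrow> ('a, 'i, 'e) tensor2 \<Rightarrow> ('a, 'i, 'e) tensor2"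
  where "ricci M g i p = local_ricci (\<lambda>x. g i (chart_inv M i x)) (mchart M i p)"

text \<open>The scalar curvature at \<open>p\<close> does not depend on the chart around \<open>p\<close> in which it is computed.\<close>

definition scalar_curvature ::
    "('a, 'i, 'e::real_normed_vector) mfd \<Rightarrow> ('a, 'i, 'e) tensor2 \<Rightarrow> 'a \<Rightarrow> real"
  where "scalar_curvature M g p =
    (let i = (SOME i. i \<in> mindex M \<and> p \<in> mdom M i)
     in local_scalar (\<lambda>x. g i (chart_inv M i x)) (mchart M i p))"

definition einstein_manifold ::
    "nat \<Rightarrow> ('a, 'i, 'e::real_normed_vector) mfd \<Rightarrow> ('a, 'i, 'e) tensor2 \<Rightarrow> bool"
  where "einstein_manifold m M g \<longleftrightarrow>
    smooth_manifold m M \<and> pseudo_riemannian M g \<and>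
    (\<exists>c. \<forall>p\<in>mcarrier M. scalar_curvature M g p = c) \<and>
    (\<forall>i\<in>mindex M. \<forall>p\<in>mdom M i. \<forall>v w.
       ricci M g i p v w = 1 / real m * scalar_curvature M g p * g i p v w)"


section \<open>Cones and the ambient manifold\<close>

definition cone_mfd :: "('a, 'i, 'e) mfd \<Rightarrow> ('a \<times> real, 'i \<times> unit, 'e \<times> real) mfd"
  where "cone_mfd M = prod_mfd M (line_mfd {0<..})"

text \<open>The metric \<open>\<lambda> s\<^sup>2 g + \<epsilon> ds\<^sup>2\<close> on the cone.\<close>

definition cone_metric ::
    "real \<Rightarrow> real \<Rightarrow> ('a, 'i, 'e) tensor2 \<Rightarrow> ('a \<times> real, 'i \<times> unit, 'e \<times> real) tensor2"
  where "cone_metric lam \<epsilon> g =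
    (\<lambda>(i, _) (p, s) (v, \<sigma>) (w, \<sigma>'). lam * s\<^sup>2 * g i p v w + \<epsilon> * \<sigma> * \<sigma>')"

text \<open>
  The point \<open>(p, t\<^sup>2 g(p))\<close> of the bundle of metrics conformally related to \<open>g\<close>. The bilinear form
  \<open>t\<^sup>2 g(p)\<close> on the tangent space at \<open>p\<close> is recorded by its components in all charts around \<open>p\<close>, and
  by 0 for the other indices.
\<close>

definition scaled_metric_at ::
    "('a, 'i, 'e) mfd \<Rightarrow> ('a, 'i, 'e) tensor2 \<Rightarrow> 'a \<Rightarrow> real \<Rightarrow> 'a \<times> ('i \<Rightarrow> 'e \<Rightarrow> 'e \<Rightarrow> real)"
  where "scaled_metric_at M g p t =
    (p, \<lambda>i v w. if i \<in> mindex M \<and> p \<in> mdom M i then t\<^sup>2 * g i p v w else 0)"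

definition fibre_coord ::
    "('a, 'i, 'e) mfd \<Rightarrow> ('a, 'i, 'e) tensor2 \<Rightarrow> 'a \<times> ('i \<Rightarrow> 'e \<Rightarrow> 'e \<Rightarrow> real) \<Rightarrow> real"
  where "fibre_coord M g x = (THE t. 0 < t \<and> x = scaled_metric_at M g (fst x) t)"

definition metric_bundle ::
    "('a, 'i, 'e) mfd \<Rightarrow> ('a, 'i, 'e) tensor2 \<Rightarrow>
     ('a \<times> ('i \<Rightarrow> 'e \<Rightarrow> 'e \<Rightarrow> real), 'i \<times> unit, 'e \<times> real) mfd"
  where "metric_bundle M g =
    transport_mfd {scaled_metric_at M g p t | p t. p \<in> mcarrier M \<and> 0 < t}
      (\<lambda>x. (fst x, fibre_coord M g x)) (prod_mfd M (line_mfd {0<..}))"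

definition ambient_interval :: "nat \<Rightarrow> real \<Rightarrow> real set"
  where "ambient_interval m\<^sub>2 \<mu> = (if m\<^sub>2 = 0 then UNIV - {-1 / \<mu>} else UNIV - {1 / \<mu>, -1 / \<mu>})"

text \<open>The parameter \<open>m\<^sub>2\<close> is the dimension of \<open>M\<^sub>2\<close>.\<close>

definition ambient_mfd ::
    "nat \<Rightarrow> real \<Rightarrow> ('a, 'i, 'e) mfd \<Rightarrow> ('a, 'i, 'e) tensor2 \<Rightarrow>
     ('b, 'j, 'f) mfd \<Rightarrow> ('b, 'j, 'f) tensor2 \<Rightarrow>
     ((('a \<times> 'b) \<times> ('i \<times> 'j \<Rightarrow> 'e \<times> 'f \<Rightarrow> 'e \<times> 'f \<Rightarrow> real)) \<times> real,
      (('i \<times> 'j) \<times> unit) \<times> unit, (('e \<times> 'f) \<times> real) \<times> real) mfd"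
  where "ambient_mfd m\<^sub>2 \<mu> M\<^sub>1 g\<^sub>1 M\<^sub>2 g\<^sub>2 =
    prod_mfd (metric_bundle (prod_mfd M\<^sub>1 M\<^sub>2) (metric_product g\<^sub>1 g\<^sub>2)) (line_mfd (ambient_interval m\<^sub>2 \<mu>))"

text \<open>
  In the chart below, the tangent vector \<open>(((v\<^sub>1, v\<^sub>2), \<tau>), r)\<close> has \<open>dt\<close>-component \<open>\<tau>\<close> and
  \<open>d\<rho>\<close>-component \<open>r\<close>; the term \<open>2 t dt d\<rho>\<close> denotes the symmetric product
  \<open>t (dt \<otimes> d\<rho> + d\<rho> \<otimes> dt)\<close>.
\<close>

definition ambient_metric ::
    "real \<Rightarrow> ('a, 'i, 'e) mfd \<Rightarrow> ('a, 'i, 'e) tensor2 \<Rightarrow>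
     ('b, 'j, 'f) mfd \<Rightarrow> ('b, 'j, 'f) tensor2 \<Rightarrow>
     ((('a \<times> 'b) \<times> ('i \<times> 'j \<Rightarrow> 'e \<times> 'f \<Rightarrow> 'e \<times> 'f \<Rightarrow> real)) \<times> real,
      (('i \<times> 'j) \<times> unit) \<times> unit, (('e \<times> 'f) \<times> real) \<times> real) tensor2"
  where "ambient_metric \<mu> M\<^sub>1 g\<^sub>1 M\<^sub>2 g\<^sub>2 =
    (\<lambda>(((i, j), _), _) (x, \<rho>) (((v\<^sub>1, v\<^sub>2), \<tau>), r) (((w\<^sub>1, w\<^sub>2), \<tau>'), r').
       let t = fibre_coord (prod_mfd M\<^sub>1 M\<^sub>2) (metric_product g\<^sub>1 g\<^sub>2) x; (p\<^sub>1, p\<^sub>2) = fst x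
       in t * (\<tau> * r' + r * \<tau>') + 2 * \<rho> * \<tau> * \<tau>'
          + t\<^sup>2 * ((1 + \<mu> * \<rho>)\<^sup>2 * g\<^sub>1 i p\<^sub>1 v\<^sub>1 w\<^sub>1 + (1 - \<mu> * \<rho>)\<^sup>2 * g\<^sub>2 j p\<^sub>2 v\<^sub>2 w\<^sub>2))"

definition ambient_proj :: "('p \<times> 'q) \<times> real \<Rightarrow> 'p"
  where "ambient_proj = (\<lambda>((p, _), _). p)"

definition cones_proj :: "('a \<times> real) \<times> ('b \<times> real) \<Rightarrow> 'a \<times> 'b"
  where "cones_proj = (\<lambda>((p\<^sub>1, _), (p\<^sub>2, _)). (p\<^sub>1, p\<^sub>2))"

end

theory Submission
  imports Defs
begin

text \<open>
  Put \<open>s\<^sub>1 = t (1 + \<mu> \<rho>) / \<surd>\<lambda>\<close> and \<open>s\<^sub>2 = t (1 - \<mu> \<rho>) / \<surd>\<lambda>\<close>. Then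
  \<open>\<lambda> s\<^sub>1\<^sup>2 = t\<^sup>2 (1 + \<mu> \<rho>)\<^sup>2\<close> and \<open>\<lambda> s\<^sub>2\<^sup>2 = t\<^sup>2 (1 - \<mu> \<rho>)\<^sup>2\<close>, and \<open>\<lambda> = 2 \<mu>\<close> gives
  \<open>ds\<^sub>1\<^sup>2 - ds\<^sub>2\<^sup>2 = (4 / \<lambda>) dt d(\<mu> t \<rho>) = 2 t dt d\<rho> + 2 \<rho> dt\<^sup>2\<close>. The substitution is a
  diffeomorphism from \<open>t > 0\<close>, \<open>\<bar>\<rho>\<bar> < 1 / \<mu>\<close> onto \<open>s\<^sub>1, s\<^sub>2 > 0\<close>, with inverse
  \<open>t = \<surd>\<lambda> (s\<^sub>1 + s\<^sub>2) / 2\<close>, \<open>\<rho> = (s\<^sub>1 - s\<^sub>2) / (\<mu> (s\<^sub>1 + s\<^sub>2))\<close>.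
\<close>

section \<open>Smooth functions\<close>

text \<open>Both derivatives are chosen from the same predicate, because locally equal functions
  have the same derivatives at \<open>x\<close>. The equality therefore holds even where no
  derivative exists.\<close>

lemma frechet_derivative_cong_open:
  assumes "open S" "x \<in> S" "\<And>y. y \<in> S \<Longrightarrow> f y = g y"
  shows "frechet_derivative f (at x) = frechet_derivative g (at x)"
proof -
  have "(f has_derivative D) (at x) \<longleftrightarrow> (g has_derivative D) (at x)" for D
    using assms has_derivative_transform_within_open[of f D x UNIV S g]
      has_derivative_transform_within_open[of g D x UNIV S f] by auto
  then show ?thesis
    by (simp add: frechet_derivative_def)
qed

lemma Ck_on_has_derivative:
  "Ck_on (Suc k) f S \<Longrightarrow> x \<in> S \<Longrightarrow> (f has_derivative frechet_derivative f (at x)) (at x)"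
  by (simp add: frechet_derivative_works)

text \<open>Openness of \<open>S\<close> makes the agreement hold near each point, so it passes to
  the directional derivatives and the induction can be applied to those.\<close>

lemma Ck_on_cong:
  assumes "open S" "\<And>x. x \<in> S \<Longrightarrow> f x = g x" "Ck_on k f S"
  shows "Ck_on k g S"
  using assms(2,3)
proof (induction k arbitrary: f g)
  case 0
  then show ?case
    by (simp cong: continuous_on_cong)
next
  case (Suc k)
  have fr: "frechet_derivative f (at x) = frechet_derivative g (at x)" if "x \<in> S" for x
    using Suc.prems(1) that assms(1) by (intro frechet_derivative_cong_open[of S]) auto
  have "g differentiable (at x)" if "x \<in> S" for x
    using has_derivative_transform_within_open[OF Ck_on_has_derivative[OF Suc.prems(2) that]
        assms(1) that Suc.prems(1)]
    by (auto simp: differentiable_def)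
  moreover have "Ck_on k (\<lambda>x. frechet_derivative g (at x) v) S" for v
    by (rule Suc.IH[of "\<lambda>x. frechet_derivative f (at x) v"]) (use Suc.prems(2) fr in auto)
  ultimately show ?case
    by simp
qed

lemma Ck_on_SucD: "Ck_on (Suc k) f S \<Longrightarrow> Ck_on k f S"
proof (induction k arbitrary: f)
  case 0
  then show ?case
    by (auto intro!: continuous_at_imp_continuous_on differentiable_imp_continuous_within)
next
  case (Suc k)
  \<comment> \<open>Only the outermost level is unfolded, so the directional derivatives keep the
    form \<open>Ck_on (Suc k)\<close> that the induction hypothesis expects.\<close>
  then have "\<forall>x\<in>S. f differentiable (at x)"
    and "\<forall>v. Ck_on k (\<lambda>x. frechet_derivative f (at x) v) S"
    unfolding Ck_on.simps(2)[of "Suc k"] by blast+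
  then show ?case
    by simp
qed

text \<open>Uniqueness of the derivative identifies the explicit \<open>D\<close> with
  \<open>frechet_derivative\<close>, so later proofs can work with closed formulas only.\<close>

lemma Ck_on_SucI:
  assumes "open S" "\<And>x. x \<in> S \<Longrightarrow> (f has_derivative D x) (at x)"
    "\<And>v. Ck_on k (\<lambda>x. D x v) S"
  shows "Ck_on (Suc k) f S"
proof -
  have "Ck_on k (\<lambda>x. frechet_derivative f (at x) v) S" for v
    by (rule Ck_on_cong[OF assms(1) _ assms(3)]) (simp add: frechet_derivative_at[OF assms(2)])
  then show ?thesis
    using assms(2) by (auto simp: differentiable_def)
qed

section \<open>Closure properties of functions of class C^k\<close>

lemma Ck_on_const: "open S \<Longrightarrow> Ck_on k (\<lambda>x. c) S"
proof (induction k arbitrary: c)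
  case (Suc k)
  then show ?case
    by (intro Ck_on_SucI[where D = "\<lambda>_ _. 0"]) auto
qed auto

lemma Ck_on_linear:
  assumes "bounded_linear L" "open S"
  shows "Ck_on k L S"
proof (cases k)
  case 0
  then show ?thesis
    using assms by (simp add: linear_continuous_on)
next
  case (Suc k)
  show ?thesis
    unfolding Suc using assms
    by (intro Ck_on_SucI[where D = "\<lambda>_. L"] bounded_linear_imp_has_derivative Ck_on_const)
qed

text \<open>The derivative in direction \<open>v\<close> is a directional derivative of
  \<open>f\<close>, in the fixed direction \<open>L v\<close>, composed with \<open>L\<close> again,
  so the induction closes. This form of the chain rule suffices below: chart transitions are
  composed only with coordinate projections.\<close>

lemma Ck_on_compose_linear:
  assumes L: "bounded_linear L" and T: "open T" "L ` T \<subseteq> S" and "Ck_on k f S"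
  shows "Ck_on k (\<lambda>x. f (L x)) T"
  using assms(4)
proof (induction k arbitrary: f)
  case 0
  then show ?case
    using continuous_on_compose2[OF _ linear_continuous_on[OF L] T(2)] by simp
next
  case (Suc k)
  show ?case
  proof (rule Ck_on_SucI[OF T(1)])
    show "((\<lambda>x. f (L x)) has_derivative (\<lambda>v. frechet_derivative f (at (L x)) (L v))) (at x)"
      if "x \<in> T" for x
      using has_derivative_compose[OF bounded_linear_imp_has_derivative[OF L]]
        Ck_on_has_derivative[OF Suc.prems] T(2) that by blast
    show "Ck_on k (\<lambda>x. frechet_derivative f (at (L x)) (L v)) T" for v
      using Suc by auto
  qed
qed

lemma Ck_on_Pair:
  assumes "open S" "Ck_on k f S" "Ck_on k g S"
  shows "Ck_on k (\<lambda>x. (f x, g x)) S"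
  using assms(2,3)
proof (induction k arbitrary: f g)
  case (Suc k)
  then show ?case
    using Ck_on_has_derivative[OF Suc.prems(1)] Ck_on_has_derivative[OF Suc.prems(2)]
    by (intro Ck_on_SucI[OF assms(1), where D = "\<lambda>x v.
        (frechet_derivative f (at x) v, frechet_derivative g (at x) v)"] has_derivative_Pair) auto
qed (auto intro: continuous_on_Pair)

lemma Ck_on_add:
  assumes "open S" "Ck_on k f S" "Ck_on k g S"
  shows "Ck_on k (\<lambda>x. f x + g x) S"
  using assms(2,3)
proof (induction k arbitrary: f g)
  case (Suc k)
  then show ?case
    using Ck_on_has_derivative[OF Suc.prems(1)] Ck_on_has_derivative[OF Suc.prems(2)]
    by (intro Ck_on_SucI[OF assms(1), where D = "\<lambda>x v.
        frechet_derivative f (at x) v + frechet_derivative g (at x) v"] has_derivative_add) auto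
qed (auto intro: continuous_intros)

lemma Ck_on_mult:
  fixes f g :: "'e::real_normed_vector \<Rightarrow> real"
  assumes "open S" "Ck_on k f S" "Ck_on k g S"
  shows "Ck_on k (\<lambda>x. f x * g x) S"
  using assms(2,3)
proof (induction k arbitrary: f g)
  case (Suc k)
  \<comment> \<open>The product rule also contains the undifferentiated factors, which must be known
    one level lower.\<close>
  note lower = Ck_on_SucD[OF Suc.prems(1)] Ck_on_SucD[OF Suc.prems(2)]
  show ?case
  proof (rule Ck_on_SucI[OF assms(1)])
    show "((\<lambda>x. f x * g x) has_derivative (\<lambda>v. f x * frechet_derivative g (at x) v
        + frechet_derivative f (at x) v * g x)) (at x)" if "x \<in> S" for x
      using Ck_on_has_derivative[OF Suc.prems(1) that] Ck_on_has_derivative[OF Suc.prems(2) that]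
      by (rule has_derivative_mult)
    show "Ck_on k (\<lambda>x. f x * frechet_derivative g (at x) v
        + frechet_derivative f (at x) v * g x) S" for v
      using Suc.prems lower by (intro Ck_on_add[OF assms(1)] Suc.IH) auto
  qed
qed (auto intro: continuous_intros)

lemma Ck_on_diff:
  fixes f g :: "'e::real_normed_vector \<Rightarrow> real"
  assumes "open S" "Ck_on k f S" "Ck_on k g S"
  shows "Ck_on k (\<lambda>x. f x - g x) S"
  using Ck_on_add[OF assms(1,2) Ck_on_mult[OF assms(1) Ck_on_const[OF assms(1), of k "-1"] assms(3)]]
  by simp

text \<open>The derivative of \<open>1 / f\<close> is a product of \<open>1 / f\<close> with itself
  and with a derivative of \<open>f\<close>. The induction hypothesis covers the former, and the
  sign is written as a constant factor so that the product rule covers the rest.\<close>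

lemma Ck_on_inverse:
  fixes f :: "'e::real_normed_vector \<Rightarrow> real"
  assumes "open S" "\<And>x. x \<in> S \<Longrightarrow> f x \<noteq> 0" "Ck_on k f S"
  shows "Ck_on k (\<lambda>x. inverse (f x)) S"
  using assms(3)
proof (induction k)
  case 0
  then show ?case
    using assms(2) by (auto intro: continuous_intros)
next
  case (Suc k)
  note IH = Suc.IH[OF Ck_on_SucD[OF Suc.prems]]
  show ?case
  proof (rule Ck_on_SucI[OF assms(1)])
    show "((\<lambda>x. inverse (f x)) has_derivative
        (\<lambda>v. (-1) * (inverse (f x) * frechet_derivative f (at x) v * inverse (f x)))) (at x)"
      if "x \<in> S" for x
      using Deriv.has_derivative_inverse[OF assms(2)[OF that] Ck_on_has_derivative[OF Suc.prems that]]
      by simp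
    show "Ck_on k (\<lambda>x. (-1) * (inverse (f x) * frechet_derivative f (at x) v * inverse (f x))) S"
      for v
      using Suc.prems IH by (intro Ck_on_mult[OF assms(1)] Ck_on_const[OF assms(1)]) auto
  qed
qed

lemma Ck_on_divide:
  fixes f g :: "'e::real_normed_vector \<Rightarrow> real"
  assumes "open S" "Ck_on k f S" "Ck_on k g S" "\<And>x. x \<in> S \<Longrightarrow> g x \<noteq> 0"
  shows "Ck_on k (\<lambda>x. f x / g x) S"
  unfolding divide_inverse using assms by (intro Ck_on_mult Ck_on_inverse)

lemma Cinf_on_imp_has_derivative:
  "Cinf_on f S \<Longrightarrow> x \<in> S \<Longrightarrow> (f has_derivative frechet_derivative f (at x)) (at x)"
  unfolding Cinf_on_def using Ck_on_has_derivative by blast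

section \<open>Coordinate expressions of maps\<close>

text \<open>This replaces \<open>local_rep\<close>, which contains an \<open>inv_into\<close>, by an
  explicit formula \<open>h\<close>. Injectivity of the chart makes \<open>chart_inv\<close> undo it
  on its domain, and openness of \<open>T\<close> makes derivatives of \<open>h\<close> and of the
  local representation agree.\<close>

definition coord_expr ::
    "('a, 'i, 'e::real_normed_vector) mfd \<Rightarrow> ('b, 'j, 'f::real_normed_vector) mfd \<Rightarrow>
     ('a \<Rightarrow> 'b) \<Rightarrow> 'i \<Rightarrow> 'j \<Rightarrow> ('e \<Rightarrow> 'f) \<Rightarrow> 'e set \<Rightarrow> bool"
  where "coord_expr M N F i j h T \<longleftrightarrow>
    inj_on (mchart M i) (mdom M i) \<and> open T \<and>
    mchart M i ` (mdom M i \<inter> F -` mdom N j) = T \<and>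
    (\<forall>p\<in>mdom M i \<inter> F -` mdom N j. mchart N j (F p) = h (mchart M i p))"

lemma coord_expr_local_rep:
  assumes "coord_expr M N F i j h T" "z \<in> T"
  shows "local_rep M N F i j z = h z"
  using assms unfolding coord_expr_def local_rep_def chart_inv_def by force

lemma coord_expr_Cinf_on:
  assumes "coord_expr M N F i j h T" "Cinf_on h T"
  shows "Cinf_on (local_rep M N F i j) (mchart M i ` (mdom M i \<inter> F -` mdom N j))"
proof -
  have "open T" "mchart M i ` (mdom M i \<inter> F -` mdom N j) = T"
    using assms(1) by (auto simp: coord_expr_def)
  then show ?thesis
    using assms(2) Ck_on_cong[of T h "local_rep M N F i j"] coord_expr_local_rep[OF assms(1)]
    by (simp add: Cinf_on_def)
qed

lemma coord_expr_derivative: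
  assumes "coord_expr M N F i j h T" "p \<in> mdom M i \<inter> F -` mdom N j"
    and "(h has_derivative D) (at (mchart M i p))"
  shows "frechet_derivative (local_rep M N F i j) (at (mchart M i p)) = D"
proof -
  have T: "open T" "mchart M i p \<in> T"
    using assms(1,2) by (auto simp: coord_expr_def)
  have "(local_rep M N F i j has_derivative D) (at (mchart M i p))"
    using has_derivative_transform_within_open[OF assms(3) T]
      coord_expr_local_rep[OF assms(1)] by auto
  then show ?thesis
    by (simp add: frechet_derivative_at[symmetric])
qed

text \<open>Agreement on the source chart domain is enough. This serves for an inverse given by
  \<open>inv_into\<close>, which is controlled only on the carrier.\<close>

lemma coord_expr_cong:
  assumes "coord_expr M N F i j h T" "\<And>p. p \<in> mdom M i \<Longrightarrow> F p = G p"
  shows "coord_expr M N G i j h T"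
proof -
  have "mdom M i \<inter> F -` mdom N j = mdom M i \<inter> G -` mdom N j"
    using assms(2) by auto
  then show ?thesis
    using assms unfolding coord_expr_def by auto
qed

text \<open>The chart is a homeomorphism onto its image, so it maps an overlap to a relatively open
  set; the image is itself open, so this set is open in the model space.\<close>

lemma smooth_manifold_chart:
  assumes "smooth_manifold m M" "i \<in> mindex M"
  shows smooth_manifold_inj_on: "inj_on (mchart M i) (mdom M i)"
    and smooth_manifold_dom_subset: "mdom M i \<subseteq> mcarrier M"
    and smooth_manifold_open_image: "j \<in> mindex M \<Longrightarrow> open (mchart M i ` (mdom M i \<inter> mdom M j))"
proof -
  have op: "openin (mtop M) (mdom M i)" and im: "open (mchart M i ` mdom M i)"
    and hom: "homeomorphic_map (subtopology (mtop M) (mdom M i))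
      (top_of_set (mchart M i ` mdom M i)) (mchart M i)"
    using assms by (auto simp: smooth_manifold_def)
  show sub: "mdom M i \<subseteq> mcarrier M"
    using op by (rule openin_subset)
  then show "inj_on (mchart M i) (mdom M i)"
    using homeomorphic_imp_injective_map[OF hom] by (simp add: Int_absorb1)
  assume "j \<in> mindex M"
  then have "openin (mtop M) (mdom M j)"
    using assms(1) by (auto simp: smooth_manifold_def)
  then have "openin (subtopology (mtop M) (mdom M i)) (mdom M i \<inter> mdom M j)"
    by (simp add: openin_subtopology_Int2)
  then have "openin (top_of_set (mchart M i ` mdom M i)) (mchart M i ` (mdom M i \<inter> mdom M j))"
    using homeomorphic_imp_open_map[OF hom] by (simp add: open_map_def)
  then show "open (mchart M i ` (mdom M i \<inter> mdom M j))"
    using im openin_open_trans by blast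
qed

section \<open>The bundle of metrics\<close>

text \<open>Where the metric vanished, \<open>scaled_metric_at\<close> would not determine \<open>t\<close> and the \<open>THE\<close> in
  \<open>fibre_coord\<close> would have no unique witness.\<close>

definition nowhere_zero :: "('a, 'i, 'e) mfd \<Rightarrow> ('a, 'i, 'e) tensor2 \<Rightarrow> bool"
  where "nowhere_zero M g \<longleftrightarrow>
    (\<forall>p\<in>mcarrier M. \<exists>i\<in>mindex M. p \<in> mdom M i \<and> (\<exists>v w. g i p v w \<noteq> 0))"

lemma fst_scaled_metric_at [simp]: "fst (scaled_metric_at M g p t) = p"
  by (simp add: scaled_metric_at_def)

text \<open>A nonzero component of the metric at \<open>p\<close> recovers \<open>t\<^sup>2\<close>
  from the recorded form, and positivity selects the root.\<close>

lemma fibre_coord_scaled: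
  assumes "nowhere_zero M g" "p \<in> mcarrier M" "0 < t"
  shows "fibre_coord M g (scaled_metric_at M g p t) = t"
proof -
  obtain i v w where i: "i \<in> mindex M" "p \<in> mdom M i" "g i p v w \<noteq> 0"
    using assms(1,2) unfolding nowhere_zero_def by blast
  have eq: "s = t" if "0 < s" "scaled_metric_at M g p t = scaled_metric_at M g p s" for s
  proof -
    have "t\<^sup>2 * g i p v w = s\<^sup>2 * g i p v w"
      using arg_cong[OF that(2), of "\<lambda>x. snd x i v w"] i by (simp add: scaled_metric_at_def)
    then show ?thesis
      using i(3) that(1) assms(3) by (simp add: power2_eq_iff_nonneg)
  qed
  show ?thesis
    unfolding fibre_coord_def fst_scaled_metric_at
    by (rule the_equality) (use assms(3) eq in blast)+
qed

text \<open>The pullback topology keeps only points whose coordinates lie in the target carrier.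
  None is lost, since \<open>fibre_coord\<close> returns the positive parameter
  \<open>t\<close>.\<close>

lemma mcarrier_metric_bundle:
  assumes "nowhere_zero M g"
  shows "mcarrier (metric_bundle M g) = {scaled_metric_at M g p t | p t. p \<in> mcarrier M \<and> 0 < t}"
proof -
  have "(fst x, fibre_coord M g x) \<in> mcarrier M \<times> {0<..}"
    if "x \<in> {scaled_metric_at M g p t | p t. p \<in> mcarrier M \<and> 0 < t}" for x
    using that fibre_coord_scaled[OF assms] by auto
  then have "{scaled_metric_at M g p t | p t. p \<in> mcarrier M \<and> 0 < t}
      \<subseteq> (\<lambda>x. (fst x, fibre_coord M g x)) -` (mcarrier M \<times> {0<..})"
    by blast
  then show ?thesis
    unfolding metric_bundle_def transport_mfd_def prod_mfd_def line_mfd_def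
    by (simp add: topspace_pullback_topology Int_absorb1)
qed

lemma mdom_metric_bundle:
  assumes "nowhere_zero M g" "mdom M i \<subseteq> mcarrier M"
  shows "mdom (metric_bundle M g) (i, u) = {scaled_metric_at M g p t | p t. p \<in> mdom M i \<and> 0 < t}"
proof -
  have "scaled_metric_at M g p t \<in> mdom (metric_bundle M g) (i, u)" if "p \<in> mdom M i" "0 < t" for p t
    using that assms(2) fibre_coord_scaled[OF assms(1) _ that(2), of p]
    by (auto simp: metric_bundle_def transport_mfd_def prod_mfd_def line_mfd_def)
  moreover have "\<exists>p t. x = scaled_metric_at M g p t \<and> p \<in> mdom M i \<and> 0 < t"
    if x: "x \<in> mdom (metric_bundle M g) (i, u)" for x
  proof -
    obtain p t where "x = scaled_metric_at M g p t" "0 < t"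
      using x by (auto simp: metric_bundle_def transport_mfd_def)
    moreover from this have "p \<in> mdom M i"
      using x by (auto simp: metric_bundle_def transport_mfd_def prod_mfd_def line_mfd_def)
    ultimately show ?thesis
      by blast
  qed
  ultimately show ?thesis
    by blast
qed

lemma mchart_metric_bundle:
  "mchart (metric_bundle M g) (i, u) x = (mchart M i (fst x), fibre_coord M g x)"
  by (simp add: metric_bundle_def transport_mfd_def prod_mfd_def line_mfd_def)

lemma mindex_metric_bundle: "mindex (metric_bundle M g) = mindex M \<times> UNIV"
  by (auto simp: metric_bundle_def transport_mfd_def prod_mfd_def line_mfd_def)

lemma continuous_map_metric_bundle_coords:
  "continuous_map (mtop (metric_bundle M g)) (prod_topology (mtop M) (top_of_set {0<..}))
     (\<lambda>x. (fst x, fibre_coord M g x))"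
  unfolding metric_bundle_def transport_mfd_def prod_mfd_def line_mfd_def
  by (simp, rule continuous_map_pullback[where g = id, unfolded id_o, OF continuous_map_id])

lemma continuous_map_fst_metric_bundle:
  "continuous_map (mtop (metric_bundle M g)) (mtop M) fst"
  using continuous_map_metric_bundle_coords[of M g] by (simp add: continuous_map_pairwise o_def)

lemma continuous_map_fibre_coord:
  "continuous_map (mtop (metric_bundle M g)) euclideanreal (fibre_coord M g)"
  using continuous_map_metric_bundle_coords[of M g]
  by (simp add: continuous_map_pairwise o_def continuous_map_in_subtopology)

text \<open>By the universal property of the pullback topology, continuity can be tested after
  applying the bundle coordinates, which turn the map back into the pair of \<open>a\<close> and
  \<open>t\<close>.\<close>

lemma continuous_map_into_metric_bundle:
  assumes "nowhere_zero M g" "continuous_map X (mtop M) a" "continuous_map X euclideanreal t"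
    and pos: "\<And>z. z \<in> topspace X \<Longrightarrow> 0 < t z"
  shows "continuous_map X (mtop (metric_bundle M g)) (\<lambda>z. scaled_metric_at M g (a z) (t z))"
proof -
  have a: "a z \<in> mcarrier M" if "z \<in> topspace X" for z
    using assms(2) that by (auto simp: continuous_map_def)
  have "continuous_map X (prod_topology (mtop M) (top_of_set {0<..})) (\<lambda>z. (a z, t z))"
    using assms by (auto simp: continuous_map_pairwise o_def continuous_map_in_subtopology)
  then have "continuous_map X (prod_topology (mtop M) (top_of_set {0<..}))
      ((\<lambda>x. (fst x, fibre_coord M g x)) \<circ> (\<lambda>z. scaled_metric_at M g (a z) (t z)))"
    by (rule continuous_map_eq) (use a pos fibre_coord_scaled[OF assms(1)] in auto)
  then show ?thesis
    unfolding metric_bundle_def transport_mfd_def prod_mfd_def line_mfd_def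
    by (simp, intro continuous_map_pullback') (use a pos in auto)
qed

section \<open>The ambient metric as a product of cones\<close>

locale ambient_product =
  fixes M\<^sub>1 :: "('a, 'i, 'e::real_normed_vector) mfd" and g\<^sub>1 :: "('a, 'i, 'e) tensor2"
    and M\<^sub>2 :: "('b, 'j, 'f::real_normed_vector) mfd" and g\<^sub>2 :: "('b, 'j, 'f) tensor2"
    and m\<^sub>1 m\<^sub>2 :: nat and \<mu> :: real
  assumes m1: "1 \<le> m\<^sub>1"
    and mfd1: "smooth_manifold m\<^sub>1 M\<^sub>1" and mfd2: "smooth_manifold m\<^sub>2 M\<^sub>2"
    and met1: "pseudo_riemannian M\<^sub>1 g\<^sub>1" and met2: "pseudo_riemannian M\<^sub>2 g\<^sub>2"
    and mu: "0 < \<mu>"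
begin

abbreviation P where "P \<equiv> prod_mfd M\<^sub>1 M\<^sub>2"
abbreviation G where "G \<equiv> metric_product g\<^sub>1 g\<^sub>2"
abbreviation B where "B \<equiv> metric_bundle P G"
abbreviation amb where "amb \<equiv> ambient_mfd m\<^sub>2 \<mu> M\<^sub>1 g\<^sub>1 M\<^sub>2 g\<^sub>2"
abbreviation cones where "cones \<equiv> prod_mfd (cone_mfd M\<^sub>1) (cone_mfd M\<^sub>2)"
abbreviation J where "J \<equiv> {-1 / \<mu><..<1 / \<mu>}"

text \<open>Over \<open>J\<close> both \<open>1 + \<mu> * \<rho>\<close> and
  \<open>1 - \<mu> * \<rho>\<close> are positive, so both radii are. For
  \<open>m\<^sub>2 = 0\<close> the ambient interval continues past \<open>1 / \<mu>\<close>, where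
  the second radius is no longer positive.\<close>

definition nbhd where "nbhd = mcarrier B \<times> J"

abbreviation ambN where "ambN \<equiv> open_submfd amb nbhd"

definition radius1 :: "real \<Rightarrow> real \<Rightarrow> real"
  where "radius1 t \<rho> = t * (1 + \<mu> * \<rho>) / sqrt (2 * \<mu>)"

definition radius2 :: "real \<Rightarrow> real \<Rightarrow> real"
  where "radius2 t \<rho> = t * (1 - \<mu> * \<rho>) / sqrt (2 * \<mu>)"

text \<open>\<open>radial_mean\<close> is the fibre coordinate t, and \<open>slope\<close> the
  coordinate \<rho>, in terms of the two cone radii.\<close>

definition radial_mean :: "real \<Rightarrow> real \<Rightarrow> real"
  where "radial_mean s s' = sqrt (2 * \<mu>) * (s + s') / 2"

definition slope :: "real \<Rightarrow> real \<Rightarrow> real"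
  where "slope s s' = (s - s') / (\<mu> * (s + s'))"

definition to_cones
  where "to_cones = (\<lambda>(x, \<rho>). ((fst (fst x), radius1 (fibre_coord P G x) \<rho>),
    (snd (fst x), radius2 (fibre_coord P G x) \<rho>)))"

definition from_cones
  where "from_cones = (\<lambda>((p, s), (q, s')). (scaled_metric_at P G (p, q) (radial_mean s s'), slope s s'))"

section \<open>The change of variables between (t, \<rho>) and the two radii\<close>

lemma factor_pos:
  assumes "\<rho> \<in> J"
  shows "0 < 1 + \<mu> * \<rho>" "0 < 1 - \<mu> * \<rho>"
  using assms mu by (auto simp: field_simps)

lemma radius_pos:
  assumes "0 < t" "\<rho> \<in> J"
  shows "0 < radius1 t \<rho>" "0 < radius2 t \<rho>"
  using assms mu factor_pos[OF assms(2)] by (auto simp: radius1_def radius2_def)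

lemma radial_mean_pos: "0 < s \<Longrightarrow> 0 < s' \<Longrightarrow> 0 < radial_mean s s'"
  using mu by (simp add: radial_mean_def)

lemma slope_in: "0 < s \<Longrightarrow> 0 < s' \<Longrightarrow> slope s s' \<in> J"
  using mu by (auto simp: slope_def divide_simps)

lemma radial_mean_radius: "radial_mean (radius1 t \<rho>) (radius2 t \<rho>) = t"
proof -
  have "radius1 t \<rho> + radius2 t \<rho> = 2 * t / sqrt (2 * \<mu>)"
    by (simp add: radius1_def radius2_def add_divide_distrib[symmetric] algebra_simps)
  then show ?thesis
    using mu by (simp add: radial_mean_def)
qed

lemma slope_radius:
  assumes "0 < t"
  shows "slope (radius1 t \<rho>) (radius2 t \<rho>) = \<rho>"
proof -
  have "radius1 t \<rho> + radius2 t \<rho> = 2 * t / sqrt (2 * \<mu>)"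
    and "radius1 t \<rho> - radius2 t \<rho> = 2 * t * \<mu> * \<rho> / sqrt (2 * \<mu>)"
    by (simp_all add: radius1_def radius2_def add_divide_distrib[symmetric]
        diff_divide_distrib[symmetric] algebra_simps)
  then show ?thesis
    using mu assms by (simp add: slope_def)
qed

lemma radius_radial_mean_slope:
  assumes "0 < s" "0 < s'"
  shows "radius1 (radial_mean s s') (slope s s') = s" "radius2 (radial_mean s s') (slope s s') = s'"
proof -
  have "\<mu> * slope s s' = (s - s') / (s + s')" "s + s' \<noteq> 0"
    using assms mu by (auto simp: slope_def)
  \<comment> \<open>The denominators cancel against the factor \<open>s + s'\<close> of
    \<open>radial_mean\<close>.\<close>
  then have "1 + \<mu> * slope s s' = 2 * s / (s + s')" "1 - \<mu> * slope s s' = 2 * s' / (s + s')"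
    by (simp_all add: nonzero_eq_divide_eq distrib_right left_diff_distrib)
  then show "radius1 (radial_mean s s') (slope s s') = s" "radius2 (radial_mean s s') (slope s s') = s'"
    using assms mu by (simp_all add: radius1_def radius2_def radial_mean_def)
qed

section \<open>Carriers and charts, and the bijection of the neighbourhood with the cones\<close>

lemma P_simps [simp]:
  "mtop P = prod_topology (mtop M\<^sub>1) (mtop M\<^sub>2)"
  "mindex P = mindex M\<^sub>1 \<times> mindex M\<^sub>2"
  "mdom P (i, j) = mdom M\<^sub>1 i \<times> mdom M\<^sub>2 j"
  "mchart P (i, j) (p, q) = (mchart M\<^sub>1 i p, mchart M\<^sub>2 j q)"
  by (simp_all add: prod_mfd_def)

lemma cones_simps [simp]:
  "mtop cones = prod_topology (prod_topology (mtop M\<^sub>1) (top_of_set {0<..}))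
     (prod_topology (mtop M\<^sub>2) (top_of_set {0<..}))"
  "mindex cones = (mindex M\<^sub>1 \<times> UNIV) \<times> (mindex M\<^sub>2 \<times> UNIV)"
  "mdom cones ((i, u), (j, u')) = (mdom M\<^sub>1 i \<times> {0<..}) \<times> (mdom M\<^sub>2 j \<times> {0<..})"
  "mchart cones ((i, u), (j, u')) ((p, s), (q, s')) =
     ((mchart M\<^sub>1 i p, s), (mchart M\<^sub>2 j q, s'))"
  by (auto simp: prod_mfd_def cone_mfd_def line_mfd_def)

text \<open>Since \<open>1 \<le> m\<^sub>1\<close>, there is a nonzero tangent vector of
  \<open>M\<^sub>1\<close>, and nondegeneracy of \<open>g\<^sub>1\<close> pairs it nontrivially with
  another. This makes the fibre coordinate well defined, also when \<open>M\<^sub>2\<close> is a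
  point.\<close>

lemma nowhere_zero: "nowhere_zero P G"
  unfolding nowhere_zero_def
proof
  fix p assume "p \<in> mcarrier P"
  then obtain p\<^sub>1 p\<^sub>2 where p: "p = (p\<^sub>1, p\<^sub>2)" "p\<^sub>1 \<in> mcarrier M\<^sub>1" "p\<^sub>2 \<in> mcarrier M\<^sub>2"
    by auto
  obtain i where i: "i \<in> mindex M\<^sub>1" "p\<^sub>1 \<in> mdom M\<^sub>1 i"
    using p(2) mfd1 unfolding smooth_manifold_def by auto
  obtain j where j: "j \<in> mindex M\<^sub>2" "p\<^sub>2 \<in> mdom M\<^sub>2 j"
    using p(3) mfd2 unfolding smooth_manifold_def by auto
  have "\<exists>v :: 'e. v \<noteq> 0"
  proof (rule ccontr)
    assume "\<not> (\<exists>v :: 'e. v \<noteq> 0)"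
    then have "(UNIV :: 'e set) = {0}"
      by auto
    \<comment> \<open>The zero space is spanned by the empty set, so its dimension is the
      cardinality of an empty basis.\<close>
    then have "dim (UNIV :: 'e set) = 0"
      using real_vector.dim_span_eq_card_independent[OF real_vector.independent_empty, where ?'a = 'e]
      by simp
    then show False
      using mfd1 m1 by (simp add: smooth_manifold_def)
  qed
  then obtain v :: 'e where "v \<noteq> 0" ..
  then obtain w where w: "g\<^sub>1 i p\<^sub>1 v w \<noteq> 0"
    using met1 i unfolding pseudo_riemannian_def by blast
  have "bilinear (g\<^sub>2 j p\<^sub>2)"
    using met2 j unfolding pseudo_riemannian_def by blast
  \<comment> \<open>Extending both vectors by zero removes the \<open>g\<^sub>2\<close>
    term.\<close>
  then have "G (i, j) p (v, 0) (w, 0) \<noteq> 0"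
    using w p by (simp add: metric_product_def bilinear_lzero)
  then show "\<exists>i\<in>mindex P. p \<in> mdom P i \<and> (\<exists>v w. G i p v w \<noteq> 0)"
    using i j p by (intro bexI[of _ "(i, j)"]) auto
qed

lemmas fibre_coord_P = fibre_coord_scaled[OF nowhere_zero]

lemma mcarrier_B: "mcarrier B = {scaled_metric_at P G (p, q) t | p q t.
    p \<in> mcarrier M\<^sub>1 \<and> q \<in> mcarrier M\<^sub>2 \<and> 0 < t}"
  unfolding mcarrier_metric_bundle[OF nowhere_zero] by auto

lemma J_subset: "J \<subseteq> ambient_interval m\<^sub>2 \<mu>"
  using mu by (auto simp: ambient_interval_def)

lemma nbhd_subset: "nbhd \<subseteq> mcarrier B \<times> ambient_interval m\<^sub>2 \<mu>"
  using J_subset unfolding nbhd_def by blast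

lemma mtop_amb: "mtop amb = prod_topology (mtop B) (top_of_set (ambient_interval m\<^sub>2 \<mu>))"
  by (simp add: ambient_mfd_def prod_mfd_def line_mfd_def)

lemma openin_nbhd: "openin (mtop amb) nbhd"
proof -
  have "openin (top_of_set (ambient_interval m\<^sub>2 \<mu>)) J"
    using J_subset by (rule open_subset) simp
  then show ?thesis
    unfolding mtop_amb nbhd_def by (simp add: openin_prod_Times_iff)
qed

lemma mcarrier_ambN [simp]: "mcarrier ambN = nbhd"
  using nbhd_subset by (simp add: open_submfd_def mtop_amb Int_absorb1)

lemma mindex_ambN [simp]: "mindex ambN = ((mindex M\<^sub>1 \<times> mindex M\<^sub>2) \<times> UNIV) \<times> UNIV"
  \<comment> \<open>The instance of \<open>prod_mfd_def\<close> unfolds only the product with the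
    \<rho>-interval and leaves \<open>P\<close> folded for its own rules.\<close>
  by (auto simp: open_submfd_def ambient_mfd_def prod_mfd_def[of "metric_bundle _ _"] line_mfd_def
      mindex_metric_bundle)

text \<open>A chart domain of the bundle already lies in its carrier, so intersecting with
  \<open>nbhd\<close> only cuts the \<rho>-interval down to \<open>J\<close>.\<close>

lemma mdom_ambN:
  assumes "i \<in> mindex M\<^sub>1" "j \<in> mindex M\<^sub>2"
  shows "mdom ambN (((i, j), u), u') = {(scaled_metric_at P G (p, q) t, \<rho>) | p q t \<rho>.
    p \<in> mdom M\<^sub>1 i \<and> q \<in> mdom M\<^sub>2 j \<and> 0 < t \<and> \<rho> \<in> J}"
proof -
  have sub: "mdom M\<^sub>1 i \<subseteq> mcarrier M\<^sub>1" "mdom M\<^sub>2 j \<subseteq> mcarrier M\<^sub>2"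
    using smooth_manifold_dom_subset[OF mfd1] smooth_manifold_dom_subset[OF mfd2] assms by blast+
  then have "mdom P (i, j) \<subseteq> mcarrier P"
    by auto
  note dom = mdom_metric_bundle[OF nowhere_zero this, of u]
  have "mdom ambN (((i, j), u), u') =
      (mdom B ((i, j), u) \<times> ambient_interval m\<^sub>2 \<mu>) \<inter> nbhd"
    by (simp add: open_submfd_def ambient_mfd_def prod_mfd_def[of "metric_bundle _ _"] line_mfd_def)
  also have "\<dots> = mdom B ((i, j), u) \<times> J"
  proof -
    have "mdom B ((i, j), u) \<subseteq> mcarrier B"
      using sub unfolding dom mcarrier_B by auto blast
    then show ?thesis
      using J_subset unfolding nbhd_def by blast
  qed
  also have "\<dots> = {(scaled_metric_at P G (p, q) t, \<rho>) | p q t \<rho>.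
      p \<in> mdom M\<^sub>1 i \<and> q \<in> mdom M\<^sub>2 j \<and> 0 < t \<and> \<rho> \<in> J}"
    unfolding dom by auto blast
  finally show ?thesis .
qed

lemma mchart_ambN:
  assumes "p \<in> mcarrier M\<^sub>1" "q \<in> mcarrier M\<^sub>2" "0 < t"
  shows "mchart ambN (((i, j), u), u') (scaled_metric_at P G (p, q) t, \<rho>) =
    (((mchart M\<^sub>1 i p, mchart M\<^sub>2 j q), t), \<rho>)"
  using assms fibre_coord_P
  by (simp add: open_submfd_def ambient_mfd_def prod_mfd_def[of "metric_bundle _ _"] line_mfd_def
      mchart_metric_bundle)

lemma to_cones_scaled:
  assumes "p \<in> mcarrier M\<^sub>1" "q \<in> mcarrier M\<^sub>2" "0 < t"
  shows "to_cones (scaled_metric_at P G (p, q) t, \<rho>) = ((p, radius1 t \<rho>), (q, radius2 t \<rho>))"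
  using assms fibre_coord_P by (simp add: to_cones_def)

lemma from_to_cones:
  assumes "x \<in> nbhd"
  shows "from_cones (to_cones x) = x"
proof -
  obtain p q t \<rho> where "x = (scaled_metric_at P G (p, q) t, \<rho>)"
    "p \<in> mcarrier M\<^sub>1" "q \<in> mcarrier M\<^sub>2" "0 < t"
    using assms unfolding nbhd_def mcarrier_B by auto
  then show ?thesis
    by (simp add: to_cones_scaled from_cones_def radial_mean_radius slope_radius)
qed

lemma to_from_cones:
  assumes "y \<in> mcarrier cones"
  shows "to_cones (from_cones y) = y"
  using assms by (auto simp: from_cones_def to_cones_scaled radial_mean_pos radius_radial_mean_slope)

lemma from_cones_in_nbhd:
  assumes "y \<in> mcarrier cones"
  shows "from_cones y \<in> nbhd"
proof -
  obtain p s q s' where y: "y = ((p, s), (q, s'))"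
    by (metis prod.collapse)
  show ?thesis
    using assms radial_mean_pos[of s s'] slope_in[of s s']
    unfolding y nbhd_def mcarrier_B from_cones_def by auto
qed

lemma bij_betw_to_cones: "bij_betw to_cones nbhd (mcarrier cones)"
proof (rule bij_betw_byWitness[where f' = from_cones])
  have "to_cones x \<in> mcarrier cones" if "x \<in> nbhd" for x
  proof -
    obtain b \<rho> where x: "x = (b, \<rho>)" "b \<in> mcarrier B" "\<rho> \<in> J"
      using \<open>x \<in> nbhd\<close> unfolding nbhd_def by (rule SigmaE)
    obtain p q t where "b = scaled_metric_at P G (p, q) t"
      "p \<in> mcarrier M\<^sub>1" "q \<in> mcarrier M\<^sub>2" "0 < t"
      using x(2) unfolding mcarrier_B by blast
    with x(1,3) show ?thesis
      using radius_pos[of t \<rho>] by (simp add: to_cones_scaled)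
  qed
  then show "to_cones ` nbhd \<subseteq> mcarrier cones"
    by blast
  show "from_cones ` mcarrier cones \<subseteq> nbhd"
    using from_cones_in_nbhd by blast
qed (use from_to_cones to_from_cones in blast)+

text \<open>\<open>diffeomorphism\<close> fixes the inverse as an \<open>inv_into\<close>; this lets
  the explicit formula stand in for it on the carrier of the cones.\<close>

lemma inv_into_to_cones:
  assumes "y \<in> mcarrier cones"
  shows "inv_into nbhd to_cones y = from_cones y"
proof -
  obtain x where "x \<in> nbhd" "y = to_cones x"
    using assms bij_betw_imp_surj_on[OF bij_betw_to_cones] by blast
  then show ?thesis
    using bij_betw_inv_into_left[OF bij_betw_to_cones] from_to_cones by simp
qed

section \<open>Continuity in both directions\<close>

lemma continuous_map_to_cones: "continuous_map (mtop ambN) (mtop cones) to_cones"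
proof -
  have top: "mtop ambN = subtopology (mtop amb) nbhd"
    by (simp add: open_submfd_def)
  have x: "continuous_map (mtop ambN) (mtop B) fst"
    and \<rho>: "continuous_map (mtop ambN) euclideanreal snd"
    unfolding top mtop_amb
    by (intro continuous_map_from_subtopology continuous_map_fst
        continuous_map_into_fulltopology[OF continuous_map_snd])+
  have p: "continuous_map (mtop ambN) (prod_topology (mtop M\<^sub>1) (mtop M\<^sub>2)) (\<lambda>z. fst (fst z))"
    using continuous_map_compose[OF x continuous_map_fst_metric_bundle] by (simp add: o_def)
  have t: "continuous_map (mtop ambN) euclideanreal (\<lambda>z. fibre_coord P G (fst z))"
    using continuous_map_compose[OF x continuous_map_fibre_coord] by (simp add: o_def)
  \<comment> \<open>The half-lines carry the subspace topology, so continuity into them is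
    continuity into the reals together with positivity.\<close>
  have "0 < radius1 (fibre_coord P G x) \<rho>" "0 < radius2 (fibre_coord P G x) \<rho>"
    if "(x, \<rho>) \<in> nbhd" for x \<rho>
  proof -
    have "x \<in> mcarrier B" "\<rho> \<in> J"
      using that by (auto simp: nbhd_def)
    then show "0 < radius1 (fibre_coord P G x) \<rho>" "0 < radius2 (fibre_coord P G x) \<rho>"
      using radius_pos fibre_coord_P unfolding mcarrier_B by auto
  qed
  moreover have "continuous_map (mtop ambN) euclideanreal
      (\<lambda>z. radius1 (fibre_coord P G (fst z)) (snd z))"
    and "continuous_map (mtop ambN) euclideanreal (\<lambda>z. radius2 (fibre_coord P G (fst z)) (snd z))"
    unfolding radius1_def radius2_def using mu
    by (auto intro!: continuous_intros t \<rho>)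
  ultimately show ?thesis
    using continuous_map_compose[OF p continuous_map_fst]
      continuous_map_compose[OF p continuous_map_snd]
    by (auto simp: continuous_map_pairwise to_cones_def o_def case_prod_unfold
        continuous_map_in_subtopology)
qed

lemma continuous_map_from_cones: "continuous_map (mtop cones) (mtop ambN) from_cones"
proof -
  \<comment> \<open>The local name keeps the domain topology from being expanded by
    \<open>cones_simps\<close>.\<close>
  define C where "C = mtop cones"
  have 1: "continuous_map C (prod_topology (mtop M\<^sub>1) (top_of_set {0<..})) fst"
    and 2: "continuous_map C (prod_topology (mtop M\<^sub>2) (top_of_set {0<..})) snd"
    by (simp_all add: C_def continuous_map_fst continuous_map_snd)
  have p: "continuous_map C (mtop M\<^sub>1) (\<lambda>z. fst (fst z))"
    and q: "continuous_map C (mtop M\<^sub>2) (\<lambda>z. fst (snd z))"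
    and s: "continuous_map C euclideanreal (\<lambda>z. snd (fst z))"
    and s': "continuous_map C euclideanreal (\<lambda>z. snd (snd z))"
    using continuous_map_compose[OF 1 continuous_map_fst]
      continuous_map_compose[OF 2 continuous_map_fst]
      continuous_map_into_fulltopology[OF continuous_map_compose[OF 1 continuous_map_snd]]
      continuous_map_into_fulltopology[OF continuous_map_compose[OF 2 continuous_map_snd]]
    by (simp_all add: o_def)
  have pos: "0 < snd (fst z)" "0 < snd (snd z)" if "z \<in> topspace C" for z
    using that by (auto simp: C_def)
  have "continuous_map C (mtop B)
      (\<lambda>z. scaled_metric_at P G (fst (fst z), fst (snd z)) (radial_mean (snd (fst z)) (snd (snd z))))"
  proof (rule continuous_map_into_metric_bundle[OF nowhere_zero])
    show "continuous_map C (mtop P) (\<lambda>z. (fst (fst z), fst (snd z)))"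
      using p q by (simp add: continuous_map_pairwise o_def)
    show "continuous_map C euclideanreal (\<lambda>z. radial_mean (snd (fst z)) (snd (snd z)))"
      unfolding radial_mean_def by (auto intro!: continuous_intros s s')
  qed (use pos radial_mean_pos in blast)
  moreover have "continuous_map C euclideanreal (\<lambda>z. slope (snd (fst z)) (snd (snd z)))"
    unfolding slope_def using mu pos
    by (intro continuous_intros s s') (auto simp: add_pos_pos less_imp_neq[symmetric])
  moreover have nbhd: "from_cones z \<in> nbhd" if "z \<in> topspace C" for z
    using that unfolding C_def by (rule from_cones_in_nbhd)
  \<comment> \<open>The \<rho>-factor of \<open>amb\<close> has the subspace topology of the whole
    ambient interval, so membership there is required in addition to membership in
    \<open>nbhd\<close>.\<close>
  moreover have "snd (from_cones z) \<in> ambient_interval m\<^sub>2 \<mu>" if "z \<in> topspace C" for z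
    using nbhd[OF that] nbhd_subset by auto
  ultimately show ?thesis
    unfolding C_def[symmetric]
    by (auto simp: open_submfd_def mtop_amb continuous_map_in_subtopology continuous_map_pairwise
        from_cones_def o_def case_prod_unfold image_subset_iff mem_Times_iff)
qed


section \<open>The two maps in charts\<close>

abbreviation trans1 where "trans1 i i' \<equiv> mchart M\<^sub>1 i' \<circ> chart_inv M\<^sub>1 i"
abbreviation trans2 where "trans2 j j' \<equiv> mchart M\<^sub>2 j' \<circ> chart_inv M\<^sub>2 j"

abbreviation dom1 where "dom1 i i' \<equiv> mchart M\<^sub>1 i ` (mdom M\<^sub>1 i \<inter> mdom M\<^sub>1 i')"
abbreviation dom2 where "dom2 j j' \<equiv> mchart M\<^sub>2 j ` (mdom M\<^sub>2 j \<inter> mdom M\<^sub>2 j')"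

lemma trans_chart:
  "i \<in> mindex M\<^sub>1 \<Longrightarrow> p \<in> mdom M\<^sub>1 i \<Longrightarrow> trans1 i i' (mchart M\<^sub>1 i p) = mchart M\<^sub>1 i' p"
  "j \<in> mindex M\<^sub>2 \<Longrightarrow> q \<in> mdom M\<^sub>2 j \<Longrightarrow> trans2 j j' (mchart M\<^sub>2 j q) = mchart M\<^sub>2 j' q"
  using smooth_manifold_inj_on[OF mfd1, of i] smooth_manifold_inj_on[OF mfd2, of j]
  by (simp_all add: chart_inv_def)

lemma dom_subset:
  "i \<in> mindex M\<^sub>1 \<Longrightarrow> p \<in> mdom M\<^sub>1 i \<Longrightarrow> p \<in> mcarrier M\<^sub>1"
  "j \<in> mindex M\<^sub>2 \<Longrightarrow> q \<in> mdom M\<^sub>2 j \<Longrightarrow> q \<in> mcarrier M\<^sub>2"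
  using smooth_manifold_dom_subset[OF mfd1] smooth_manifold_dom_subset[OF mfd2] by blast+

lemma open_dom:
  "i \<in> mindex M\<^sub>1 \<Longrightarrow> i' \<in> mindex M\<^sub>1 \<Longrightarrow> open (dom1 i i')"
  "j \<in> mindex M\<^sub>2 \<Longrightarrow> j' \<in> mindex M\<^sub>2 \<Longrightarrow> open (dom2 j j')"
  using smooth_manifold_open_image[OF mfd1] smooth_manifold_open_image[OF mfd2] by blast+

lemma Cinf_on_trans:
  "i \<in> mindex M\<^sub>1 \<Longrightarrow> i' \<in> mindex M\<^sub>1 \<Longrightarrow> Cinf_on (trans1 i i') (dom1 i i')"
  "j \<in> mindex M\<^sub>2 \<Longrightarrow> j' \<in> mindex M\<^sub>2 \<Longrightarrow> Cinf_on (trans2 j j') (dom2 j j')"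
  using mfd1 mfd2 unfolding smooth_manifold_def by blast+

text \<open>The maps fix the base points, but source and target charts may differ; hence the
  transition functions in the base components.\<close>

definition to_cones_rep
  where "to_cones_rep i i' j j' = (\<lambda>z.
    ((trans1 i i' (fst (fst (fst z))), radius1 (snd (fst z)) (snd z)),
     (trans2 j j' (snd (fst (fst z))), radius2 (snd (fst z)) (snd z))))"

definition from_cones_rep
  where "from_cones_rep i i' j j' = (\<lambda>z.
    (((trans1 i i' (fst (fst z)), trans2 j j' (fst (snd z))),
      radial_mean (snd (fst z)) (snd (snd z))), slope (snd (fst z)) (snd (snd z))))"

text \<open>Radii are automatically positive over \<open>J\<close>, so the target chart restricts
  only the base points \<open>p\<close> and \<open>q\<close>.\<close>

lemma preimage_to_cones:
  assumes ind: "i \<in> mindex M\<^sub>1" "j \<in> mindex M\<^sub>2"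
  shows "mdom ambN (((i, j), u), v) \<inter> to_cones -` mdom cones ((i', u'), (j', v')) =
    {(scaled_metric_at P G (p, q) t, \<rho>) | p q t \<rho>.
      p \<in> mdom M\<^sub>1 i \<inter> mdom M\<^sub>1 i' \<and> q \<in> mdom M\<^sub>2 j \<inter> mdom M\<^sub>2 j' \<and> 0 < t \<and> \<rho> \<in> J}"
    (is "?A = ?B")
proof
  have F: "to_cones (scaled_metric_at P G (p, q) t, \<rho>) = ((p, radius1 t \<rho>), (q, radius2 t \<rho>))"
    if "p \<in> mdom M\<^sub>1 i" "q \<in> mdom M\<^sub>2 j" "0 < t" for p q t \<rho>
    using that dom_subset ind by (intro to_cones_scaled) blast+
  show "?A \<subseteq> ?B"
  proof
    fix x assume x: "x \<in> ?A"
    then obtain p q t \<rho> where "x = (scaled_metric_at P G (p, q) t, \<rho>)"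
      "p \<in> mdom M\<^sub>1 i" "q \<in> mdom M\<^sub>2 j" "0 < t" "\<rho> \<in> J"
      unfolding mdom_ambN[OF ind] by blast
    moreover from this x have "p \<in> mdom M\<^sub>1 i'" "q \<in> mdom M\<^sub>2 j'"
      by (simp_all add: F)
    ultimately show "x \<in> ?B"
      by blast
  qed
  show "?B \<subseteq> ?A"
  proof
    fix x assume "x \<in> ?B"
    then obtain p q t \<rho> where x: "x = (scaled_metric_at P G (p, q) t, \<rho>)"
      "p \<in> mdom M\<^sub>1 i \<inter> mdom M\<^sub>1 i'" "q \<in> mdom M\<^sub>2 j \<inter> mdom M\<^sub>2 j'" "0 < t" "\<rho> \<in> J"
      by blast
    then have "to_cones x \<in> mdom cones ((i', u'), (j', v'))"
      using radius_pos[of t \<rho>] by (simp add: F)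
    then show "x \<in> ?A"
      using x unfolding mdom_ambN[OF ind] by blast
  qed
qed

lemma inj_on_mchart_ambN:
  assumes ind: "i \<in> mindex M\<^sub>1" "j \<in> mindex M\<^sub>2"
  shows "inj_on (mchart ambN (((i, j), u), v)) (mdom ambN (((i, j), u), v))"
proof (rule inj_onI)
  fix x y
  assume xy: "x \<in> mdom ambN (((i, j), u), v)" "y \<in> mdom ambN (((i, j), u), v)"
    and eq: "mchart ambN (((i, j), u), v) x = mchart ambN (((i, j), u), v) y"
  obtain p q t \<rho> where x: "x = (scaled_metric_at P G (p, q) t, \<rho>)"
    "p \<in> mdom M\<^sub>1 i" "q \<in> mdom M\<^sub>2 j" "0 < t"
    using xy(1) unfolding mdom_ambN[OF ind] by blast
  obtain p' q' t' \<rho>' where y: "y = (scaled_metric_at P G (p', q') t', \<rho>')"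
    "p' \<in> mdom M\<^sub>1 i" "q' \<in> mdom M\<^sub>2 j" "0 < t'"
    using xy(2) unfolding mdom_ambN[OF ind] by blast
  have "mchart M\<^sub>1 i p = mchart M\<^sub>1 i p'" "mchart M\<^sub>2 j q = mchart M\<^sub>2 j q'" "t = t'" "\<rho> = \<rho>'"
    using eq x y dom_subset(1)[OF ind(1)] dom_subset(2)[OF ind(2)] by (simp_all add: mchart_ambN)
  then show "x = y"
    using x y smooth_manifold_inj_on[OF mfd1 ind(1)] smooth_manifold_inj_on[OF mfd2 ind(2)]
    by (simp add: inj_on_eq_iff)
qed

lemma coord_expr_to_cones:
  assumes ind: "i \<in> mindex M\<^sub>1" "i' \<in> mindex M\<^sub>1" "j \<in> mindex M\<^sub>2" "j' \<in> mindex M\<^sub>2"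
  shows "coord_expr ambN cones to_cones (((i, j), u), v) ((i', u'), (j', v'))
    (to_cones_rep i i' j j') (((dom1 i i' \<times> dom2 j j') \<times> {0 :: real<..}) \<times> J)"
  unfolding coord_expr_def preimage_to_cones[OF ind(1,3)]
proof (intro conjI ballI)
  let ?D = "{(scaled_metric_at P G (p, q) t, \<rho>) | p q t \<rho>.
      p \<in> mdom M\<^sub>1 i \<inter> mdom M\<^sub>1 i' \<and> q \<in> mdom M\<^sub>2 j \<inter> mdom M\<^sub>2 j' \<and> 0 < t \<and> \<rho> \<in> J}"
    and ?c = "mchart ambN (((i, j), u), v)"
  have c: "?c (scaled_metric_at P G (p, q) t, \<rho>) = (((mchart M\<^sub>1 i p, mchart M\<^sub>2 j q), t), \<rho>)"
    if "p \<in> mdom M\<^sub>1 i" "q \<in> mdom M\<^sub>2 j" "0 < t" for p q t \<rho>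
    using that dom_subset ind by (intro mchart_ambN) blast+
  show "inj_on ?c (mdom ambN (((i, j), u), v))"
    using ind by (intro inj_on_mchart_ambN)
  show "open (((dom1 i i' \<times> dom2 j j') \<times> {0 :: real<..}) \<times> J)"
    using ind by (intro open_Times open_dom) auto
  show "?c ` ?D = ((dom1 i i' \<times> dom2 j j') \<times> {0 :: real<..}) \<times> J"
  proof
    show "?c ` ?D \<subseteq> ((dom1 i i' \<times> dom2 j j') \<times> {0 :: real<..}) \<times> J"
      using c by auto
    show "((dom1 i i' \<times> dom2 j j') \<times> {0 :: real<..}) \<times> J \<subseteq> ?c ` ?D"
    proof
      fix z assume "z \<in> ((dom1 i i' \<times> dom2 j j') \<times> {0 :: real<..}) \<times> J"
      then obtain p q t \<rho> where z: "z = (((mchart M\<^sub>1 i p, mchart M\<^sub>2 j q), t), \<rho>)"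
        "p \<in> mdom M\<^sub>1 i \<inter> mdom M\<^sub>1 i'" "q \<in> mdom M\<^sub>2 j \<inter> mdom M\<^sub>2 j'" "0 < t" "\<rho> \<in> J"
        by blast
      then have "z = ?c (scaled_metric_at P G (p, q) t, \<rho>)"
        using c by simp
      moreover have "(scaled_metric_at P G (p, q) t, \<rho>) \<in> ?D"
        using z by blast
      ultimately show "z \<in> ?c ` ?D"
        by blast
    qed
  qed
  fix x assume "x \<in> ?D"
  then obtain p q t \<rho> where "x = (scaled_metric_at P G (p, q) t, \<rho>)"
    "p \<in> mdom M\<^sub>1 i" "q \<in> mdom M\<^sub>2 j" "0 < t"
    by blast
  \<comment> \<open>Deleting \<open>o_apply\<close> keeps the transition maps as compositions, the
    form in which \<open>trans_chart\<close> rewrites them.\<close>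
  then show "mchart cones ((i', u'), (j', v')) (to_cones x) = to_cones_rep i i' j j' (?c x)"
    using c dom_subset trans_chart ind by (simp add: to_cones_scaled to_cones_rep_def del: o_apply)
qed

lemma coord_expr_from_cones:
  assumes ind: "i \<in> mindex M\<^sub>1" "i' \<in> mindex M\<^sub>1" "j \<in> mindex M\<^sub>2" "j' \<in> mindex M\<^sub>2"
  shows "coord_expr cones ambN from_cones ((i, u), (j, v)) (((i', j'), u'), v')
    (from_cones_rep i i' j j') ((dom1 i i' \<times> {0<..}) \<times> (dom2 j j' \<times> {0<..}))"
proof -
  let ?c = "mchart cones ((i, u), (j, v))" and ?I = "(((i', j'), u'), v')"
  let ?D = "((mdom M\<^sub>1 i \<inter> mdom M\<^sub>1 i') \<times> {0 :: real<..}) \<times>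
    ((mdom M\<^sub>2 j \<inter> mdom M\<^sub>2 j') \<times> {0 :: real<..})"
  \<comment> \<open>Positive radii always yield a positive t and a \<rho> in \<open>J\<close>, so
    again only the base points matter.\<close>
  have mem: "from_cones ((p, s), (q, s')) \<in> mdom ambN ?I \<longleftrightarrow> p \<in> mdom M\<^sub>1 i' \<and> q \<in> mdom M\<^sub>2 j'"
    if "0 < s" "0 < s'" for p s q s'
  proof
    assume "from_cones ((p, s), (q, s')) \<in> mdom ambN ?I"
    then obtain p' q' t where "p' \<in> mdom M\<^sub>1 i'" "q' \<in> mdom M\<^sub>2 j'"
      and "scaled_metric_at P G (p, q) (radial_mean s s') = scaled_metric_at P G (p', q') t"
      unfolding mdom_ambN[OF ind(2,4)] from_cones_def by auto
    \<comment> \<open>The first component of a bundle point is its base point, so nothing about the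
      parameters has to be compared.\<close>
    moreover from this(3) have "(p, q) = (p', q')"
      by (metis fst_scaled_metric_at)
    ultimately show "p \<in> mdom M\<^sub>1 i' \<and> q \<in> mdom M\<^sub>2 j'"
      by simp
  next
    assume "p \<in> mdom M\<^sub>1 i' \<and> q \<in> mdom M\<^sub>2 j'"
    then show "from_cones ((p, s), (q, s')) \<in> mdom ambN ?I"
      using radial_mean_pos[OF that] slope_in[OF that]
      unfolding mdom_ambN[OF ind(2,4)] from_cones_def prod.case by blast
  qed
  have pre: "mdom cones ((i, u), (j, v)) \<inter> from_cones -` mdom ambN ?I = ?D"
  proof -
    have "y \<in> mdom cones ((i, u), (j, v)) \<inter> from_cones -` mdom ambN ?I \<longleftrightarrow> y \<in> ?D" for y
    proof -
      obtain p s q s' where y: "y = ((p, s), (q, s'))"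
        by (metis prod.collapse)
      show ?thesis
        unfolding y Int_iff vimage_eq cones_simps(3) mem_Times_iff fst_conv snd_conv greaterThan_iff
        using mem by blast
    qed
    then show ?thesis
      by blast
  qed
  have "inj_on ?c (mdom cones ((i, u), (j, v)))"
    using smooth_manifold_inj_on[OF mfd1 ind(1)] smooth_manifold_inj_on[OF mfd2 ind(3)]
    by (auto simp: inj_on_def)
  moreover have "open ((dom1 i i' \<times> {0 :: real<..}) \<times> (dom2 j j' \<times> {0 :: real<..}))"
    using ind by (intro open_Times open_dom) auto
  moreover have "?c ` ?D = (dom1 i i' \<times> {0<..}) \<times> (dom2 j j' \<times> {0<..})"
    by (force simp: image_iff)
  moreover have "mchart ambN ?I (from_cones y) = from_cones_rep i i' j j' (?c y)" if "y \<in> ?D" for y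
  proof -
    obtain p s q s' where y: "y = ((p, s), (q, s'))"
      by (metis prod.collapse)
    with that have "p \<in> mdom M\<^sub>1 i" "q \<in> mdom M\<^sub>2 j" "0 < s" "0 < s'"
      by auto
    with y show ?thesis
      using radial_mean_pos[of s s'] dom_subset trans_chart ind
      by (simp add: from_cones_def from_cones_rep_def mchart_ambN del: o_apply)
  qed
  ultimately show ?thesis
    unfolding coord_expr_def pre by blast
qed

section \<open>Smoothness in both directions\<close>

lemma Cinf_on_to_cones_rep:
  assumes "i \<in> mindex M\<^sub>1" "i' \<in> mindex M\<^sub>1" "j \<in> mindex M\<^sub>2" "j' \<in> mindex M\<^sub>2"
  shows "Cinf_on (to_cones_rep i i' j j') (((dom1 i i' \<times> dom2 j j') \<times> {0<..}) \<times> J)"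
    (is "Cinf_on _ ?T")
  unfolding Cinf_on_def
proof
  fix k
  have T: "open ?T"
    using assms by (intro open_Times open_dom) auto
  have t: "Ck_on k (\<lambda>z. snd (fst z)) ?T" and \<rho>: "Ck_on k (\<lambda>z. snd z) ?T"
    by (intro Ck_on_linear T bounded_linear_snd_comp bounded_linear_fst bounded_linear_snd)+
  have Cinf1: "Ck_on k (trans1 i i') (dom1 i i')" and Cinf2: "Ck_on k (trans2 j j') (dom2 j j')"
    using Cinf_on_trans assms unfolding Cinf_on_def by blast+
  have "Ck_on k (\<lambda>z. trans1 i i' (fst (fst (fst z)))) ?T"
    by (rule Ck_on_compose_linear[where S = "dom1 i i'" and L = "\<lambda>z. fst (fst (fst z))",
          OF bounded_linear_fst_comp[OF bounded_linear_fst_comp[OF bounded_linear_fst]] T _ Cinf1])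
      auto
  moreover have "Ck_on k (\<lambda>z. trans2 j j' (snd (fst (fst z)))) ?T"
    by (rule Ck_on_compose_linear[where S = "dom2 j j'" and L = "\<lambda>z. snd (fst (fst z))",
          OF bounded_linear_snd_comp[OF bounded_linear_fst_comp[OF bounded_linear_fst]] T _ Cinf2])
      auto
  moreover have "Ck_on k (\<lambda>z. radius1 (snd (fst z)) (snd z)) ?T"
    and "Ck_on k (\<lambda>z. radius2 (snd (fst z)) (snd z)) ?T"
    unfolding radius1_def radius2_def
    by (intro Ck_on_divide Ck_on_mult Ck_on_add Ck_on_diff t \<rho> Ck_on_const T; use mu in simp)+
  ultimately show "Ck_on k (to_cones_rep i i' j j') ?T"
    unfolding to_cones_rep_def by (intro Ck_on_Pair T)
qed

text \<open>The base components are transitions after linear projections. The others are rational in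
  the radii, and the denominator of \<open>slope\<close> is nonzero because \<open>\<mu>\<close> and
  both radii are positive.\<close>

lemma Cinf_on_from_cones_rep:
  assumes "i \<in> mindex M\<^sub>1" "i' \<in> mindex M\<^sub>1" "j \<in> mindex M\<^sub>2" "j' \<in> mindex M\<^sub>2"
  shows "Cinf_on (from_cones_rep i i' j j') ((dom1 i i' \<times> {0<..}) \<times> (dom2 j j' \<times> {0<..}))"
    (is "Cinf_on _ ?T")
  unfolding Cinf_on_def
proof
  fix k
  have T: "open ?T"
    using assms by (intro open_Times open_dom) auto
  have s: "Ck_on k (\<lambda>z. snd (fst z)) ?T" and s': "Ck_on k (\<lambda>z. snd (snd z)) ?T"
    by (intro Ck_on_linear T bounded_linear_snd_comp bounded_linear_fst bounded_linear_snd)+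
  have Cinf1: "Ck_on k (trans1 i i') (dom1 i i')" and Cinf2: "Ck_on k (trans2 j j') (dom2 j j')"
    using Cinf_on_trans assms unfolding Cinf_on_def by blast+
  have "Ck_on k (\<lambda>z. trans1 i i' (fst (fst z))) ?T"
    by (rule Ck_on_compose_linear[where S = "dom1 i i'" and L = "\<lambda>z. fst (fst z)",
          OF bounded_linear_fst_comp[OF bounded_linear_fst] T _ Cinf1])
      auto
  moreover have "Ck_on k (\<lambda>z. trans2 j j' (fst (snd z))) ?T"
    by (rule Ck_on_compose_linear[where S = "dom2 j j'" and L = "\<lambda>z. fst (snd z)",
          OF bounded_linear_fst_comp[OF bounded_linear_snd] T _ Cinf2])
      auto
  moreover have "Ck_on k (\<lambda>z. radial_mean (snd (fst z)) (snd (snd z))) ?T"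
    unfolding radial_mean_def
    by (intro Ck_on_divide Ck_on_mult Ck_on_add s s' Ck_on_const T) simp
  moreover have "\<mu> * (snd (fst z) + snd (snd z)) \<noteq> 0" if "z \<in> ?T" for z
  proof -
    have "0 < snd (fst z) + snd (snd z)"
      using that by auto
    then show ?thesis
      using mu by simp
  qed
  then have "Ck_on k (\<lambda>z. slope (snd (fst z)) (snd (snd z))) ?T"
    unfolding slope_def by (intro Ck_on_divide Ck_on_mult Ck_on_diff Ck_on_add s s' Ck_on_const T)
  ultimately show "Ck_on k (from_cones_rep i i' j j') ?T"
    unfolding from_cones_rep_def by (intro Ck_on_Pair T)
qed

lemma smooth_map_to_cones: "smooth_map ambN cones to_cones"
  unfolding smooth_map_def
proof (intro conjI ballI)
  fix I I' assume I: "I \<in> mindex ambN" "I' \<in> mindex cones"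
  obtain i j u v where "I = (((i, j), u), v)"
    by (metis prod.collapse)
  moreover obtain i' j' u' v' where "I' = ((i', u'), (j', v'))"
    by (metis prod.collapse)
  ultimately show "Cinf_on (local_rep ambN cones to_cones I I')
      (mchart ambN I ` (mdom ambN I \<inter> to_cones -` mdom cones I'))"
    using I coord_expr_Cinf_on[OF coord_expr_to_cones Cinf_on_to_cones_rep] by simp
qed (rule continuous_map_to_cones)

lemma smooth_map_inv_to_cones: "smooth_map cones ambN (inv_into nbhd to_cones)"
  unfolding smooth_map_def
proof (intro conjI ballI)
  show "continuous_map (mtop cones) (mtop ambN) (inv_into nbhd to_cones)"
    using continuous_map_from_cones by (rule continuous_map_eq) (simp add: inv_into_to_cones)
  fix I I' assume I: "I \<in> mindex cones" "I' \<in> mindex ambN"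
  obtain i j u v where ij: "I = ((i, u), (j, v))"
    by (metis prod.collapse)
  obtain i' j' u' v' where ij': "I' = (((i', j'), u'), v')"
    by (metis prod.collapse)
  have ind: "i \<in> mindex M\<^sub>1" "i' \<in> mindex M\<^sub>1" "j \<in> mindex M\<^sub>2" "j' \<in> mindex M\<^sub>2"
    using I ij ij' by simp_all
  have "from_cones y = inv_into nbhd to_cones y" if "y \<in> mdom cones I" for y
    using that dom_subset ind unfolding ij by (intro inv_into_to_cones[symmetric]) auto
  from coord_expr_cong[OF coord_expr_from_cones[OF ind] this[unfolded ij]]
  show "Cinf_on (local_rep cones ambN (inv_into nbhd to_cones) I I')
      (mchart cones I ` (mdom cones I \<inter> inv_into nbhd to_cones -` mdom ambN I'))"
    unfolding ij ij' by (rule coord_expr_Cinf_on[OF _ Cinf_on_from_cones_rep[OF ind]])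
qed

section \<open>The differential of the substitution and the comparison of the metrics\<close>

lemma to_cones_rep_has_derivative:
  assumes ind: "i \<in> mindex M\<^sub>1" "i' \<in> mindex M\<^sub>1" "j \<in> mindex M\<^sub>2" "j' \<in> mindex M\<^sub>2"
    and "a \<in> dom1 i i'" "b \<in> dom2 j j'"
  shows "(to_cones_rep i i' j j' has_derivative (\<lambda>w.
      ((frechet_derivative (trans1 i i') (at a) (fst (fst (fst w))),
        (snd (fst w) * (1 + \<mu> * \<rho>) + t * (\<mu> * snd w)) / sqrt (2 * \<mu>)),
       (frechet_derivative (trans2 j j') (at b) (snd (fst (fst w))),
        (snd (fst w) * (1 - \<mu> * \<rho>) - t * (\<mu> * snd w)) / sqrt (2 * \<mu>)))))
    (at (((a, b), t), \<rho>))"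
proof -
  let ?z = "(((a, b), t), \<rho>)"
  have "((\<lambda>z. trans1 i i' (fst (fst (fst z)))) has_derivative
      (\<lambda>w. frechet_derivative (trans1 i i') (at a) (fst (fst (fst w))))) (at ?z)"
    using has_derivative_compose[OF bounded_linear_imp_has_derivative[OF
        bounded_linear_fst_comp[OF bounded_linear_fst_comp[OF bounded_linear_fst]]],
        of "trans1 i i'" "frechet_derivative (trans1 i i') (at a)" ?z]
      Cinf_on_imp_has_derivative[OF Cinf_on_trans(1)[OF ind(1,2)] assms(5)]
    by (simp del: o_apply)
  moreover have "((\<lambda>z. trans2 j j' (snd (fst (fst z)))) has_derivative
      (\<lambda>w. frechet_derivative (trans2 j j') (at b) (snd (fst (fst w))))) (at ?z)"
    using has_derivative_compose[OF bounded_linear_imp_has_derivative[OF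
        bounded_linear_snd_comp[OF bounded_linear_fst_comp[OF bounded_linear_fst]]],
        of "trans2 j j'" "frechet_derivative (trans2 j j') (at b)" ?z]
      Cinf_on_imp_has_derivative[OF Cinf_on_trans(2)[OF ind(3,4)] assms(6)]
    by (simp del: o_apply)
  moreover have "((\<lambda>z. radius1 (snd (fst z)) (snd z)) has_derivative
      (\<lambda>w. (snd (fst w) * (1 + \<mu> * \<rho>) + t * (\<mu> * snd w)) / sqrt (2 * \<mu>))) (at ?z)"
    and "((\<lambda>z. radius2 (snd (fst z)) (snd z)) has_derivative
      (\<lambda>w. (snd (fst w) * (1 - \<mu> * \<rho>) - t * (\<mu> * snd w)) / sqrt (2 * \<mu>))) (at ?z)"
    unfolding radius1_def radius2_def
    \<comment> \<open>Dividing by the constant \<open>sqrt (2 * \<mu>)\<close> is a bounded linear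
      map, which leaves only a polynomial to differentiate.\<close>
    by (rule bounded_linear.has_derivative[OF bounded_linear_divide],
        (auto intro!: derivative_eq_intros simp: algebra_simps)[1])+
  ultimately show ?thesis
    unfolding to_cones_rep_def by (intro has_derivative_Pair)
qed

lemma isometry_to_cones:
  "isometry ambN (ambient_metric \<mu> M\<^sub>1 g\<^sub>1 M\<^sub>2 g\<^sub>2) cones
    (metric_product (cone_metric (2 * \<mu>) 1 g\<^sub>1) (cone_metric (2 * \<mu>) (-1) g\<^sub>2)) to_cones"
  unfolding isometry_def
proof (intro conjI ballI allI)
  show "diffeomorphism ambN cones to_cones"
    unfolding diffeomorphism_def mcarrier_ambN
    using bij_betw_to_cones smooth_map_to_cones smooth_map_inv_to_cones by blast
next
  fix I I' x and V W :: "(('e \<times> 'f) \<times> real) \<times> real"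
  assume I: "I \<in> mindex ambN" "I' \<in> mindex cones"
    and x: "x \<in> mdom ambN I \<inter> to_cones -` mdom cones I'"
  obtain i j u v where ij: "I = (((i, j), u), v)"
    by (metis prod.collapse)
  obtain i' j' u' v' where ij': "I' = ((i', u'), (j', v'))"
    by (metis prod.collapse)
  have ind: "i \<in> mindex M\<^sub>1" "i' \<in> mindex M\<^sub>1" "j \<in> mindex M\<^sub>2" "j' \<in> mindex M\<^sub>2"
    using I ij ij' by simp_all
  obtain p q t \<rho> where x_eq: "x = (scaled_metric_at P G (p, q) t, \<rho>)"
    and pq: "p \<in> mdom M\<^sub>1 i \<inter> mdom M\<^sub>1 i'" "q \<in> mdom M\<^sub>2 j \<inter> mdom M\<^sub>2 j'"
    and t: "0 < t"
    using x unfolding ij ij' preimage_to_cones[OF ind(1,3)] by blast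
  have car: "p \<in> mcarrier M\<^sub>1" "q \<in> mcarrier M\<^sub>2"
    using pq dom_subset ind by auto
  have F: "to_cones x = ((p, radius1 t \<rho>), (q, radius2 t \<rho>))"
    unfolding x_eq using car t by (rule to_cones_scaled)
  define D\<^sub>1 where "D\<^sub>1 = frechet_derivative (trans1 i i') (at (mchart M\<^sub>1 i p))"
  define D\<^sub>2 where "D\<^sub>2 = frechet_derivative (trans2 j j') (at (mchart M\<^sub>2 j q))"
  have chart: "mchart ambN I x = (((mchart M\<^sub>1 i p, mchart M\<^sub>2 j q), t), \<rho>)"
    unfolding ij x_eq using car t by (rule mchart_ambN)
  have "(to_cones_rep i i' j j' has_derivative (\<lambda>w.
      ((D\<^sub>1 (fst (fst (fst w))),
        (snd (fst w) * (1 + \<mu> * \<rho>) + t * (\<mu> * snd w)) / sqrt (2 * \<mu>)),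
       (D\<^sub>2 (snd (fst (fst w))),
        (snd (fst w) * (1 - \<mu> * \<rho>) - t * (\<mu> * snd w)) / sqrt (2 * \<mu>)))))
      (at (mchart ambN I x))"
    unfolding chart D\<^sub>1_def D\<^sub>2_def using pq by (intro to_cones_rep_has_derivative ind) auto
  then have D: "frechet_derivative (local_rep ambN cones to_cones I I') (at (mchart ambN I x)) = (\<lambda>w.
      ((D\<^sub>1 (fst (fst (fst w))),
        (snd (fst w) * (1 + \<mu> * \<rho>) + t * (\<mu> * snd w)) / sqrt (2 * \<mu>)),
       (D\<^sub>2 (snd (fst (fst w))),
        (snd (fst w) * (1 - \<mu> * \<rho>) - t * (\<mu> * snd w)) / sqrt (2 * \<mu>))))"
    using coord_expr_derivative[OF coord_expr_to_cones[OF ind]] x unfolding ij ij' by blast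
  \<comment> \<open>Compatibility of the components of a metric between two charts moves
    \<open>g\<^sub>1\<close>, and then \<open>g\<^sub>2\<close>, to the target charts.\<close>
  have g1: "g\<^sub>1 i p v w = g\<^sub>1 i' p (D\<^sub>1 v) (D\<^sub>1 w)" for v w
    using met1 ind pq unfolding pseudo_riemannian_def Let_def D\<^sub>1_def by blast
  have g2: "g\<^sub>2 j q v w = g\<^sub>2 j' q (D\<^sub>2 v) (D\<^sub>2 w)" for v w
    using met2 ind pq unfolding pseudo_riemannian_def Let_def D\<^sub>2_def by blast
  obtain v\<^sub>1 v\<^sub>2 \<tau> r where V: "V = (((v\<^sub>1, v\<^sub>2), \<tau>), r)"
    by (metis prod.collapse)
  obtain w\<^sub>1 w\<^sub>2 \<tau>' r' where W: "W = (((w\<^sub>1, w\<^sub>2), \<tau>'), r')"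
    by (metis prod.collapse)
  have rad: "2 * \<mu> * (radius1 t \<rho>)\<^sup>2 = t\<^sup>2 * (1 + \<mu> * \<rho>)\<^sup>2"
    "2 * \<mu> * (radius2 t \<rho>)\<^sup>2 = t\<^sup>2 * (1 - \<mu> * \<rho>)\<^sup>2"
    using mu by (simp_all add: radius1_def radius2_def power_divide power_mult_distrib)
  \<comment> \<open>\<open>A\<close> and \<open>A'\<close> are \<open>sqrt (2 * \<mu>)\<close> times
    the first radial components of the images of \<open>V\<close> and \<open>W\<close>;
    \<open>C\<close> and \<open>C'\<close> are the same for the second radius.\<close>
  define A A' where "A = \<tau> * (1 + \<mu> * \<rho>) + t * (\<mu> * r)"
    and "A' = \<tau>' * (1 + \<mu> * \<rho>) + t * (\<mu> * r')"
  define C C' where "C = \<tau> * (1 - \<mu> * \<rho>) - t * (\<mu> * r)"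
    and "C' = \<tau>' * (1 - \<mu> * \<rho>) - t * (\<mu> * r')"
  have sq: "sqrt (2 * \<mu>) * sqrt (2 * \<mu>) = 2 * \<mu>"
    using mu by simp
  \<comment> \<open>This is the polarised form of the identity between the difference of the squared
    radial differentials and the fibre part of the ambient metric, multiplied by
    \<open>2 * \<mu>\<close>.\<close>
  have "A * A' - C * C' = 2 * \<mu> * (t * (\<tau> * r' + r * \<tau>') + 2 * \<rho> * \<tau> * \<tau>')"
    unfolding A_def A'_def C_def C'_def by (simp add: algebra_simps)
  then have fibre: "(A / sqrt (2 * \<mu>)) * (A' / sqrt (2 * \<mu>)) - (C / sqrt (2 * \<mu>)) * (C' / sqrt (2 * \<mu>))
      = t * (\<tau> * r' + r * \<tau>') + 2 * \<rho> * \<tau> * \<tau>'"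
    unfolding times_divide_times_eq sq using mu by (simp add: diff_divide_distrib[symmetric])
  have "ambient_metric \<mu> M\<^sub>1 g\<^sub>1 M\<^sub>2 g\<^sub>2 I x V W = t * (\<tau> * r' + r * \<tau>') + 2 * \<rho> * \<tau> * \<tau>'
      + t\<^sup>2 * ((1 + \<mu> * \<rho>)\<^sup>2 * g\<^sub>1 i p v\<^sub>1 w\<^sub>1 + (1 - \<mu> * \<rho>)\<^sup>2 * g\<^sub>2 j q v\<^sub>2 w\<^sub>2)"
    using car t fibre_coord_P unfolding ij x_eq V W by (simp add: ambient_metric_def)
  also have "\<dots> = 2 * \<mu> * (radius1 t \<rho>)\<^sup>2 * g\<^sub>1 i' p (D\<^sub>1 v\<^sub>1) (D\<^sub>1 w\<^sub>1)
      + 2 * \<mu> * (radius2 t \<rho>)\<^sup>2 * g\<^sub>2 j' q (D\<^sub>2 v\<^sub>2) (D\<^sub>2 w\<^sub>2)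
      + (A / sqrt (2 * \<mu>)) * (A' / sqrt (2 * \<mu>)) - (C / sqrt (2 * \<mu>)) * (C' / sqrt (2 * \<mu>))"
    unfolding rad g1 g2 fibre[symmetric] by (simp add: distrib_left)
  also have "\<dots> = metric_product (cone_metric (2 * \<mu>) 1 g\<^sub>1) (cone_metric (2 * \<mu>) (-1) g\<^sub>2) I'
      (to_cones x)
      (frechet_derivative (local_rep ambN cones to_cones I I') (at (mchart ambN I x)) V)
      (frechet_derivative (local_rep ambN cones to_cones I I') (at (mchart ambN I x)) W)"
    unfolding D F by (simp add: ij' V W metric_product_def cone_metric_def A_def A'_def C_def C'_def)
  finally show "ambient_metric \<mu> M\<^sub>1 g\<^sub>1 M\<^sub>2 g\<^sub>2 I x V W =
      (let D = frechet_derivative (local_rep ambN cones to_cones I I') (at (mchart ambN I x))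
       in metric_product (cone_metric (2 * \<mu>) 1 g\<^sub>1) (cone_metric (2 * \<mu>) (-1) g\<^sub>2) I'
         (to_cones x) (D V) (D W))"
    by (simp only: Let_def)
qed

end

theorem proposition3p1:
  fixes M\<^sub>1 :: "('a, 'i, 'e::real_normed_vector) mfd" and g\<^sub>1 :: "('a, 'i, 'e) tensor2"
    and M\<^sub>2 :: "('b, 'j, 'f::real_normed_vector) mfd" and g\<^sub>2 :: "('b, 'j, 'f) tensor2"
    and m\<^sub>1 m\<^sub>2 :: nat and lam \<mu> :: real
  assumes "1 \<le> m\<^sub>1"
    and "einstein_manifold m\<^sub>1 M\<^sub>1 g\<^sub>1"
    and "einstein_manifold m\<^sub>2 M\<^sub>2 g\<^sub>2"
    and "m\<^sub>2 = 0 \<Longrightarrow> \<exists>q. mcarrier M\<^sub>2 = {q}"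
    and "\<forall>p\<in>mcarrier M\<^sub>1. \<forall>q\<in>mcarrier M\<^sub>2.
           real m\<^sub>2 * (real m\<^sub>2 - 1) * scalar_curvature M\<^sub>1 g\<^sub>1 p
           = - (real m\<^sub>1 * (real m\<^sub>1 - 1) * scalar_curvature M\<^sub>2 g\<^sub>2 q)"
    and "lam = 2 * \<mu>" and "lam > 0"
    and "\<forall>p\<in>mcarrier M\<^sub>1. scalar_curvature M\<^sub>1 g\<^sub>1 p = real m\<^sub>1 * (real m\<^sub>1 - 1) * lam"
    and "\<forall>q\<in>mcarrier M\<^sub>2. scalar_curvature M\<^sub>2 g\<^sub>2 q = - (real m\<^sub>2 * (real m\<^sub>2 - 1) * lam)"
  shows "\<exists>N F.
    openin (mtop (ambient_mfd m\<^sub>2 \<mu> M\<^sub>1 g\<^sub>1 M\<^sub>2 g\<^sub>2)) N \<and>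
    mcarrier (metric_bundle (prod_mfd M\<^sub>1 M\<^sub>2) (metric_product g\<^sub>1 g\<^sub>2)) \<times> {0} \<subseteq> N \<and>
    isometry
      (open_submfd (ambient_mfd m\<^sub>2 \<mu> M\<^sub>1 g\<^sub>1 M\<^sub>2 g\<^sub>2) N) (ambient_metric \<mu> M\<^sub>1 g\<^sub>1 M\<^sub>2 g\<^sub>2)
      (prod_mfd (cone_mfd M\<^sub>1) (cone_mfd M\<^sub>2))
      (metric_product (cone_metric lam 1 g\<^sub>1) (cone_metric lam (-1) g\<^sub>2)) F \<and>
    (\<forall>x\<in>N. cones_proj (F x) = ambient_proj x)"
proof -
  \<comment> \<open>Positivity of \<open>\<mu>\<close> follows from \<open>lam = 2 * \<mu>\<close>
    and \<open>lam > 0\<close>; the manifold and metric conditions are parts of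
    \<open>einstein_manifold\<close>.\<close>
  interpret ambient_product M\<^sub>1 g\<^sub>1 M\<^sub>2 g\<^sub>2 m\<^sub>1 m\<^sub>2 \<mu>
    using assms by unfold_locales (auto simp: einstein_manifold_def)
  have "mcarrier B \<times> {0} \<subseteq> nbhd"
    using mu by (auto simp: nbhd_def)
  moreover have "cones_proj (to_cones x) = ambient_proj x" for x
    by (simp add: cones_proj_def to_cones_def ambient_proj_def case_prod_unfold)
  ultimately show ?thesis
    using openin_nbhd isometry_to_cones unfolding \<open>lam = 2 * \<mu>\<close>
    by (intro exI[of _ nbhd] exI[of _ to_cones] conjI ballI)
qed

end
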